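(* Let $d>1000$. Consider reality testing for pure states $\ket{\psi}\in\mathbb{C}^d$, where the input is given via a state preparation unitary $U\in\mathbb{C}^{2d^2\times 2d^2}=(\mathbb{C}^{2d\times 2d})_{\mathsf A}\otimes(\mathbb{C}^{d\times d})_{\mathsf B}$ of $\ket\psi\bra\psi$. Then: (i) any quantum algorithm that, given only (black-box) query access to $U$ and $U^\dagger$, solves reality testing for every pure state $\ket\psi$ and every such state preparation unitary $U$ of $\ket\psi\bra\psi$ must make $\Omega(d^{1/4})$ queries; (ii) reality testing can be solved with a constant number of queries (two queries to $U$ and two to $U^*$ suffice) if query access to $U$ and its entrywise complex conjugate $U^*$ is given.
   Context: For a pure state $\ket\psi\in\mathbb{C}^d$ with amplitudes $\psi_i$, define $\mathrm{real}(\ket\psi)=|\langle\psi^*|\psi\rangle|^2=\big|\sum_{i=1}^d\psi_i^2\big|^2$, where $\ket{\psi^*}$ is the entrywise complex conjugate. Reality testing: given access to $\ket\psi$, decide with success probability at least $2/3$ whether $\mathrm{real}(\ket\psi)=1$ or $\mathrm{real}(\ket\psi)<1/10$ (promise: one of the two holds). A unitary $U\in(\mathbb{C}^{\hat d\times\hat d})_{\mathsf A}\otimes(\mathbb{C}^{d\times d})_{\mathsf B}$ is a state preparation unitary for a density matrix $\rho$ on $\mathbb{C}^d$ if $\mathrm{tr}_{\mathsf A}(U\ket0\bra0_{\mathsf{AB}}U^\dagger)=\rho_{\mathsf B}$. *)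

theory Defs
  imports Complex_Main "Jordan_Normal_Form.Matrix"
begin

text \<open>Matrices over the complex numbers, represented with Jordan_Normal_Form matrices
  (dimensions as natural numbers). Tensor index convention: for A (dim a) tensor B (dim b),
  the basis vector |x>|y> has index x*b + y.\<close>

definition adj :: "complex mat \<Rightarrow> complex mat" where
  "adj A = mat (dim_col A) (dim_row A) (\<lambda>(i,j). cnj (A $$ (j,i)))"

definition conj_mat :: "complex mat \<Rightarrow> complex mat" where
  "conj_mat A = map_mat cnj A"

definition is_unitary :: "nat \<Rightarrow> complex mat \<Rightarrow> bool" where
  "is_unitary n A \<longleftrightarrow> A \<in> carrier_mat n n \<and> A * adj A = 1\<^sub>m n \<and> adj A * A = 1\<^sub>m n"

definition kron :: "complex mat \<Rightarrow> complex mat \<Rightarrow> complex mat" where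
  "kron A B = mat (dim_row A * dim_row B) (dim_col A * dim_col B)
     (\<lambda>(i,j). A $$ (i div dim_row B, j div dim_col B) * B $$ (i mod dim_row B, j mod dim_col B))"

definition outer :: "complex vec \<Rightarrow> complex mat" where
  "outer v = mat (dim_vec v) (dim_vec v) (\<lambda>(i,j). v $ i * cnj (v $ j))"

definition ptrace_A :: "nat \<Rightarrow> nat \<Rightarrow> complex mat \<Rightarrow> complex mat" where
  "ptrace_A a b \<rho> = mat b b (\<lambda>(i,j). \<Sum>k<a. \<rho> $$ (k*b + i, k*b + j))"

definition is_pure_state :: "nat \<Rightarrow> complex vec \<Rightarrow> bool" where
  "is_pure_state d \<psi> \<longleftrightarrow> \<psi> \<in> carrier_vec d \<and> (\<Sum>i<d. (cmod (\<psi> $ i))\<^sup>2) = 1"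

definition realness :: "nat \<Rightarrow> complex vec \<Rightarrow> real" where
  "realness d \<psi> = (cmod (\<Sum>i<d. (\<psi> $ i)\<^sup>2))\<^sup>2"

definition state_prep :: "nat \<Rightarrow> complex vec \<Rightarrow> complex mat \<Rightarrow> bool" where
  "state_prep d \<psi> U \<longleftrightarrow> is_unitary (2*d*d) U \<and>
     ptrace_A (2*d) d (outer (U *\<^sub>v unit_vec (2*d*d) 0)) = outer \<psi>"

datatype query = QU | QUdag | QUconj

definition query_op :: "query \<Rightarrow> complex mat \<Rightarrow> nat \<Rightarrow> complex mat" where
  "query_op q U W = kron (case q of QU \<Rightarrow> U | QUdag \<Rightarrow> adj U | QUconj \<Rightarrow> conj_mat U) (1\<^sub>m W)"

definition final_state :: "nat \<Rightarrow> nat \<Rightarrow> complex mat \<Rightarrow> (query \<times> complex mat) list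
    \<Rightarrow> complex mat \<Rightarrow> complex vec" where
  "final_state d W V0 steps U =
     foldl (\<lambda>v (q, V). V *\<^sub>v (query_op q U W *\<^sub>v v)) (V0 *\<^sub>v unit_vec (2*d*d*W) 0) steps"

definition accept_prob :: "nat \<Rightarrow> nat set \<Rightarrow> complex vec \<Rightarrow> real" where
  "accept_prob N Acc v = (\<Sum>i\<in>{i. i < N \<and> i \<in> Acc}. (cmod (v $ i))\<^sup>2)"

definition is_alg :: "nat \<Rightarrow> nat \<Rightarrow> complex mat \<Rightarrow> (query \<times> complex mat) list \<Rightarrow> bool" where
  "is_alg d W V0 steps \<longleftrightarrow> W > 0 \<and> is_unitary (2*d*d*W) V0 \<and>
     (\<forall>s \<in> set steps. is_unitary (2*d*d*W) (snd s))"

definition solves_reality :: "nat \<Rightarrow> query set \<Rightarrow> nat \<Rightarrow> complex mat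
    \<Rightarrow> (query \<times> complex mat) list \<Rightarrow> nat set \<Rightarrow> bool" where
  "solves_reality d Q W V0 steps Acc \<longleftrightarrow> is_alg d W V0 steps \<and> fst ` set steps \<subseteq> Q \<and>
     (\<forall>\<psi> U. is_pure_state d \<psi> \<and> state_prep d \<psi> U \<longrightarrow>
        (realness d \<psi> = 1 \<longrightarrow> accept_prob (2*d*d*W) Acc (final_state d W V0 steps U) \<ge> 2/3) \<and>
        (realness d \<psi> < 1/10 \<longrightarrow> accept_prob (2*d*d*W) Acc (final_state d W V0 steps U) \<le> 1/3))"

end

theory Submission
  imports Defs "HOL-Analysis.L2_Norm"
begin

text \<open>
  Lower bound. For a set \<open>X\<close> of indices and unimodular \<open>\<beta>\<close> consider the state with amplitudes
  \<open>\<psi>\<^sub>j = \<plusminus>\<beta>\<^sub>j / sqrt d\<close>, the sign being negative iff \<open>j \<in> X\<close>, and the reflection that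
  exchanges \<open>|0>|0>\<close> with \<open>|1>|\<psi>>\<close>. It is a self-adjoint state preparation unitary, so adjoint
  queries are worthless. For \<open>\<beta> = 1\<close> the realness is 1; if half of the \<open>\<beta>\<^sub>j\<close> are \<open>\<i>\<close>, it is
  almost 0. Expand the state of the algorithm, as a function of \<open>X\<close>, in the characters
  \<open>(-1)^|S \<inter> X|\<close>; then a query moves the label \<open>S\<close> by at most two elements. Multiplying the
  coefficient at \<open>S\<close> by \<open>\<Prod>j\<in>S. \<beta>\<^sub>j\<close> changes no acceptance probability and would turn the run for
  \<open>\<beta> = 1\<close> into the one for \<open>\<beta>\<close> if every \<open>\<beta>\<^sub>j\<close> came with an element \<open>j\<close> entering \<open>S\<close> and every
  conjugate with one leaving it. The wrong transitions act on labels of size \<open>O(t)\<close> with norm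
  \<open>O(sqrt (t/d))\<close>, so after \<open>t\<close> queries the two runs are within \<open>O(sqrt (t^3/d))\<close>. This forces
  \<open>t = \<Omega>(d^(1/3))\<close>, more than is claimed.

  Upper bound. The swap test on \<open>\<psi>\<close> and its conjugate accepts with probability \<open>(1 + r)/2\<close>, where \<open>r\<close>
  is the realness; run it twice and accept iff both runs do.
\<close>

section \<open>Matrices and Kronecker products\<close>

lemma sum_mult_index:
  fixes f :: "nat \<Rightarrow> 'a::comm_monoid_add"
  shows "(\<Sum>i<m*k. f i) = (\<Sum>a<m. \<Sum>b<k. f (a*k+b))"
proof -
  have "(\<Sum>i<m*k. f i) = (\<Sum>a<m. sum f {a*k..<a*k+k})"
    by (rule sum.nat_group[symmetric])
  also have "\<dots> = (\<Sum>a<m. \<Sum>b<k. f (a*k+b))"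
  proof (rule sum.cong[OF refl])
    fix a
    have "sum f {0 + a*k..<k + a*k} = (\<Sum>b\<in>{0..<k}. f (b + a*k))"
      by (rule sum.shift_bounds_nat_ivl)
    then show "sum f {a*k..<a*k+k} = (\<Sum>b<k. f (a*k+b))"
      by (simp add: add.commute atLeast0LessThan)
  qed
  finally show ?thesis .
qed

lemma pair_index_less:
  fixes a b m k :: nat
  assumes "a < m" "b < k"
  shows "a*k + b < m*k"
proof -
  have "a*k + b < Suc a * k" using assms by simp
  also have "\<dots> \<le> m*k" using assms by (intro mult_right_mono) auto
  finally show ?thesis .
qed

lemma adj_carrier: "A \<in> carrier_mat n m \<Longrightarrow> adj A \<in> carrier_mat m n"
  by (auto simp: adj_def)

lemma dim_adj [simp]: "dim_row (adj A) = dim_col A" "dim_col (adj A) = dim_row A"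
  by (auto simp: adj_def)

lemma mult_mat_entry:
  assumes "A \<in> carrier_mat n m" "B \<in> carrier_mat m l" "i < n" "j < l"
  shows "(A * B) $$ (i,j) = (\<Sum>k<m. A $$ (i,k) * B $$ (k,j))"
  using assms by (auto simp: scalar_prod_def atLeast0LessThan intro!: sum.cong)

lemma mult_vec_entry:
  assumes "A \<in> carrier_mat n m" "v \<in> carrier_vec m" "i < n"
  shows "(A *\<^sub>v v) $ i = (\<Sum>k<m. A $$ (i,k) * v $ k)"
  using assms by (auto simp: mult_mat_vec_def scalar_prod_def atLeast0LessThan intro!: sum.cong)

lemma mult_adj_entry:
  assumes "A \<in> carrier_mat n n" "i < n" "j < n"
  shows "(A * adj A) $$ (i,j) = (\<Sum>k<n. A $$ (i,k) * cnj (A $$ (j,k)))"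
  using assms by (subst mult_mat_entry[OF assms(1) adj_carrier[OF assms(1)]]) (auto simp: adj_def)

lemma adj_mult_entry:
  assumes "A \<in> carrier_mat n n" "i < n" "j < n"
  shows "(adj A * A) $$ (i,j) = (\<Sum>k<n. cnj (A $$ (k,i)) * A $$ (k,j))"
  using assms by (subst mult_mat_entry[OF adj_carrier[OF assms(1)] assms(1)]) (auto simp: adj_def)

text \<open>Entrywise orthonormality of rows and of columns. All unitarity proofs below go through
  these two families of scalar sums instead of matrix products.\<close>

lemma is_unitary_iff:
  "is_unitary n A \<longleftrightarrow> A \<in> carrier_mat n n \<and>
     (\<forall>i<n. \<forall>j<n. (\<Sum>k<n. A $$ (i,k) * cnj (A $$ (j,k))) = (if i = j then 1 else 0)) \<and>
     (\<forall>i<n. \<forall>j<n. (\<Sum>k<n. cnj (A $$ (k,i)) * A $$ (k,j)) = (if i = j then 1 else 0))"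
    (is "_ \<longleftrightarrow> _ \<and> ?L \<and> ?R")
proof (cases "A \<in> carrier_mat n n")
  case True
  have "A * adj A = 1\<^sub>m n \<longleftrightarrow> ?L"
  proof
    assume "A * adj A = 1\<^sub>m n"
    then show ?L by (simp add: mult_adj_entry[OF True, symmetric])
  next
    assume ?L
    then show "A * adj A = 1\<^sub>m n"
      using True by (intro eq_matI) (auto simp: mult_adj_entry simp del: index_mult_mat(1))
  qed
  moreover have "adj A * A = 1\<^sub>m n \<longleftrightarrow> ?R"
  proof
    assume "adj A * A = 1\<^sub>m n"
    then show ?R by (simp add: adj_mult_entry[OF True, symmetric])
  next
    assume ?R
    then show "adj A * A = 1\<^sub>m n"
      using True by (intro eq_matI) (auto simp: adj_mult_entry simp del: index_mult_mat(1))
  qed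
  ultimately show ?thesis using True by (simp add: is_unitary_def)
qed (simp add: is_unitary_def)

text \<open>Expand the square and use orthonormality of the columns. Stated for a function
  \<open>f\<close> rather than a vector, so that it applies directly to coefficients
  \<open>h j S\<close> with the label \<open>S\<close> held fixed.\<close>

lemma unitary_sum_norm:
  assumes "is_unitary n A"
  shows "(\<Sum>i<n. (cmod (\<Sum>j<n. A $$ (i,j) * f j))\<^sup>2) = (\<Sum>j<n. (cmod (f j))\<^sup>2)"
proof -
  have orth: "(\<Sum>k<n. cnj (A $$ (k,i)) * A $$ (k,j)) = (if i = j then 1 else 0)" if "i<n" "j<n" for i j
    using assms that by (simp add: is_unitary_iff)
  have "complex_of_real (\<Sum>i<n. (cmod (\<Sum>j<n. A $$ (i,j) * f j))\<^sup>2)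
      = (\<Sum>i<n. (\<Sum>l<n. cnj (A $$ (i,l) * f l)) * (\<Sum>j<n. A $$ (i,j) * f j))"
    by (simp add: complex_norm_square mult.commute del: of_real_power)
  also have "\<dots> = (\<Sum>i<n. \<Sum>l<n. \<Sum>j<n. (cnj (f l) * f j) * (cnj (A $$ (i,l)) * A $$ (i,j)))"
    unfolding sum_product by (intro sum.cong refl) (simp add: mult_ac)
  also have "\<dots> = (\<Sum>l<n. \<Sum>j<n. \<Sum>i<n. (cnj (f l) * f j) * (cnj (A $$ (i,l)) * A $$ (i,j)))"
    \<comment> \<open>The row index \<open>i\<close> moves to the innermost sum, where
      \<open>orth\<close> evaluates it.\<close>
    by (subst sum.swap, rule sum.cong[OF refl], rule sum.swap)
  also have "\<dots> = (\<Sum>l<n. \<Sum>j<n. (cnj (f l) * f j) * (if l = j then 1 else 0))"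
    by (simp add: sum_distrib_left[symmetric] orth)
  also have "\<dots> = (\<Sum>l<n. cnj (f l) * f l)"
    by (simp add: if_distrib cong: if_cong)
  also have "\<dots> = complex_of_real (\<Sum>j<n. (cmod (f j))\<^sup>2)"
    by (simp add: complex_norm_square mult.commute del: of_real_power)
  finally show ?thesis using of_real_eq_iff by blast
qed

lemma kron_carrier:
  "A \<in> carrier_mat a b \<Longrightarrow> B \<in> carrier_mat c e \<Longrightarrow> kron A B \<in> carrier_mat (a*c) (b*e)"
  by (auto simp: kron_def)

lemma kron_entry:
  assumes "A \<in> carrier_mat n n" "B \<in> carrier_mat m m" "a < n" "a' < n" "b < m" "b' < m"
  shows "kron A B $$ (a*m+b, a'*m+b') = A $$ (a,a') * B $$ (b,b')"
  using assms pair_index_less[of a n b m] pair_index_less[of a' n b' m]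
  by (auto simp: kron_def)

lemma index_decompose:
  fixes i n m :: nat
  assumes "i < n * m"
  obtains a b where "a < n" "b < m" "i = a*m+b"
proof
  have "m > 0" using assms by (cases m) auto
  then show "i mod m < m" by simp
  show "i div m < n" using assms by (simp add: less_mult_imp_div_less)
  show "i = (i div m) * m + i mod m" by simp
qed

lemma pair_index_eq_iff:
  fixes a b a' b' m :: nat
  assumes "b < m" "b' < m"
  shows "a*m+b = a'*m+b' \<longleftrightarrow> a = a' \<and> b = b'"
proof
  assume eq: "a*m+b = a'*m+b'"
  have "(a*m+b) div m = a" "(a'*m+b') div m = a'" using assms by auto
  then have "a = a'" using eq by metis
  then show "a = a' \<and> b = b'" using eq by simp
qed simp

lemma pair_index_div_mod:
  fixes a b m :: nat
  assumes "b < m"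
  shows "(a*m+b) div m = a" "(a*m+b) mod m = b"
  using assms by simp_all

text \<open>Splitting each index into a pair turns the inner product of two rows (or columns) of the
  Kronecker product into a product of inner products of the factors.\<close>

lemma kron_unitary:
  assumes A: "is_unitary n A" and B: "is_unitary m B"
  shows "is_unitary (n*m) (kron A B)"
proof -
  have cA: "A \<in> carrier_mat n n" and cB: "B \<in> carrier_mat m m"
    using A B by (auto simp: is_unitary_def)
  have 1: "(\<Sum>k<n*m. kron A B $$ (i,k) * cnj (kron A B $$ (j,k))) = (if i = j then 1 else 0)"
    if ij: "i < n*m" "j < n*m" for i j
  proof -
    obtain a b where i: "a < n" "b < m" "i = a*m+b" using ij(1) by (rule index_decompose)
    obtain a' b' where j: "a' < n" "b' < m" "j = a'*m+b'" using ij(2) by (rule index_decompose)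
    have "(\<Sum>k<n*m. kron A B $$ (i,k) * cnj (kron A B $$ (j,k)))
        = (\<Sum>k<n. \<Sum>l<m. (A $$ (a,k) * cnj (A $$ (a',k))) * (B $$ (b,l) * cnj (B $$ (b',l))))"
      unfolding sum_mult_index using i j
      by (intro sum.cong refl) (simp add: kron_entry[OF cA cB] mult_ac)
    also have "\<dots> = (\<Sum>k<n. A $$ (a,k) * cnj (A $$ (a',k))) * (\<Sum>l<m. B $$ (b,l) * cnj (B $$ (b',l)))"
      by (simp add: sum_product)
    also have "\<dots> = (if i = j then 1 else 0)"
      using A B i j by (simp add: is_unitary_iff pair_index_eq_iff)
    finally show ?thesis .
  qed
  have 2: "(\<Sum>k<n*m. cnj (kron A B $$ (k,i)) * kron A B $$ (k,j)) = (if i = j then 1 else 0)"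
    if ij: "i < n*m" "j < n*m" for i j
  proof -
    obtain a b where i: "a < n" "b < m" "i = a*m+b" using ij(1) by (rule index_decompose)
    obtain a' b' where j: "a' < n" "b' < m" "j = a'*m+b'" using ij(2) by (rule index_decompose)
    have "(\<Sum>k<n*m. cnj (kron A B $$ (k,i)) * kron A B $$ (k,j))
        = (\<Sum>k<n. \<Sum>l<m. (cnj (A $$ (k,a)) * A $$ (k,a')) * (cnj (B $$ (l,b)) * B $$ (l,b')))"
      unfolding sum_mult_index using i j
      by (intro sum.cong refl) (simp add: kron_entry[OF cA cB] mult_ac)
    also have "\<dots> = (\<Sum>k<n. cnj (A $$ (k,a)) * A $$ (k,a')) * (\<Sum>l<m. cnj (B $$ (l,b)) * B $$ (l,b'))"
      by (simp add: sum_product)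
    also have "\<dots> = (if i = j then 1 else 0)"
      using A B i j by (simp add: is_unitary_iff pair_index_eq_iff)
    finally show ?thesis .
  qed
  show ?thesis using 1 2 cA cB by (simp add: is_unitary_iff kron_carrier)
qed

lemma one_unitary: "is_unitary n (1\<^sub>m n)"
proof -
  have "(\<Sum>k<n. 1\<^sub>m n $$ (i,k) * cnj (1\<^sub>m n $$ (j,k))) = (if i = j then 1 else 0)"
    if "i < n" "j < n" for i j
  proof -
    have "(\<Sum>k<n. 1\<^sub>m n $$ (i,k) * cnj (1\<^sub>m n $$ (j,k))) = (\<Sum>k<n. if k = i then (if i = j then 1 else 0) else 0)"
      using that by (intro sum.cong) auto
    then show ?thesis using that by simp
  qed
  moreover have "(\<Sum>k<n. cnj (1\<^sub>m n $$ (k,i)) * 1\<^sub>m n $$ (k,j)) = (if i = j then 1 else 0)"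
    if "i < n" "j < n" for i j
  proof -
    have "(\<Sum>k<n. cnj (1\<^sub>m n $$ (k,i)) * 1\<^sub>m n $$ (k,j)) = (\<Sum>k<n. if k = i then (if i = j then 1 else 0) else 0)"
      using that by (intro sum.cong) auto
    then show ?thesis using that by simp
  qed
  ultimately show ?thesis by (simp add: is_unitary_iff)
qed

section \<open>Fourier analysis over sign patterns\<close>

definition sgn_at :: "nat set \<Rightarrow> nat \<Rightarrow> complex" where
  "sgn_at X j = (if j \<in> X then -1 else 1)"

text \<open>The Walsh characters of the group of subsets under symmetric difference; the definition
  is symmetric in label and argument.\<close>

definition chi :: "nat set \<Rightarrow> nat set \<Rightarrow> complex" where
  "chi S X = (-1) ^ card (S \<inter> X)"

text \<open>Symmetric difference with \<open>{j}\<close>: on labels this is multiplication of a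
  character by the sign at \<open>j\<close>.\<close>

definition flip :: "nat set \<Rightarrow> nat \<Rightarrow> nat set" where
  "flip S j = (if j \<in> S then S - {j} else insert j S)"

lemma flip_flip [simp]: "flip (flip S j) j = S"
  by (auto simp: flip_def)

lemma flip_in_Pow: "j \<in> D \<Longrightarrow> S \<in> Pow D \<Longrightarrow> flip S j \<in> Pow D"
  by (auto simp: flip_def)

lemma sgn_at_simps [simp]: "sgn_at X j * sgn_at X j = 1" "cnj (sgn_at X j) = sgn_at X j" "cmod (sgn_at X j) = 1"
  by (auto simp: sgn_at_def)

lemma chi_flip:
  assumes "finite S"
  shows "chi (flip S j) X = sgn_at X j * chi S X"
proof (cases "j \<in> X")
  case True
  show ?thesis
  proof (cases "j \<in> S")
    case jS: True
    have "S \<inter> X = insert j ((S - {j}) \<inter> X)" using True jS by auto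
    then have "card (S \<inter> X) = Suc (card ((S - {j}) \<inter> X))" using assms by simp
    then show ?thesis using True jS by (simp add: chi_def flip_def sgn_at_def)
  next
    case jS: False
    have "insert j S \<inter> X = insert j (S \<inter> X)" using True by auto
    then have "card (insert j S \<inter> X) = Suc (card (S \<inter> X))" using assms jS by simp
    then show ?thesis using True jS by (simp add: chi_def flip_def sgn_at_def)
  qed
next
  case False
  then have "flip S j \<inter> X = S \<inter> X" by (auto simp: flip_def)
  then show ?thesis using False by (simp add: chi_def sgn_at_def)
qed

lemma chi_commute: "chi S X = chi X S"
  by (simp add: chi_def Int_commute)

lemma cnj_chi [simp]: "cnj (chi S X) = chi S X"
  by (simp add: chi_def)

lemma chi_square [simp]: "chi S X * chi S X = 1"
  by (simp add: chi_def power_add[symmetric] mult_2[symmetric])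

lemma sum_flip:
  assumes "finite D" "j \<in> D"
  shows "(\<Sum>S\<in>Pow D. f (flip S j)) = (\<Sum>S\<in>Pow D. f S)"
  by (rule sum.reindex_bij_witness[where i="\<lambda>S. flip S j" and j="\<lambda>S. flip S j"])
     (use assms flip_in_Pow in \<open>auto simp del: Pow_iff\<close>)

text \<open>If \<open>S\<close> and \<open>T\<close> differ at \<open>j\<close>, then flipping
  \<open>j\<close> in \<open>X\<close> permutes the subsets of \<open>D\<close> and negates the
  product of the two characters, so the sum equals its own negative.\<close>

lemma chi_orthogonal:
  assumes D: "finite D" and ST: "S \<in> Pow D" "T \<in> Pow D"
  shows "(\<Sum>X\<in>Pow D. chi S X * chi T X) = (if S = T then 2 ^ card D else 0)"
proof (cases "S = T")
  case True
  then show ?thesis using D by (simp add: card_Pow)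
next
  case False
  then obtain j where j: "(j \<in> S) \<noteq> (j \<in> T)" by auto
  then have jD: "j \<in> D" using ST by auto
  let ?F = "\<lambda>X. chi S X * chi T X"
  have neg: "?F (flip X j) = - ?F X" if "X \<in> Pow D" for X
  proof -
    have "finite X" using that D finite_subset by auto
    then have "chi S (flip X j) = sgn_at S j * chi S X" "chi T (flip X j) = sgn_at T j * chi T X"
      by (simp_all add: chi_commute[of _ "flip X j"] chi_flip chi_commute[of X])
    then show ?thesis using j by (auto simp: sgn_at_def)
  qed
  have "(\<Sum>X\<in>Pow D. ?F X) = (\<Sum>X\<in>Pow D. ?F (flip X j))"
    using sum_flip[OF D jD, of ?F] by simp
  also have "\<dots> = - (\<Sum>X\<in>Pow D. ?F X)"
    using neg by (simp add: sum_negf[symmetric])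
  finally show ?thesis using False by (simp add: equal_neg_zero)
qed

text \<open>The inverse Walsh transform without normalisation, which is why \<open>parseval\<close>
  carries the factor \<open>2 ^ d\<close>.\<close>

definition synth :: "nat \<Rightarrow> (nat set \<Rightarrow> complex) \<Rightarrow> nat set \<Rightarrow> complex" where
  "synth d f X = (\<Sum>S\<in>Pow {..<d}. chi S X * f S)"

lemma parseval:
  "(\<Sum>X\<in>Pow {..<d}. (cmod (synth d f X))\<^sup>2) = 2 ^ d * (\<Sum>S\<in>Pow {..<d}. (cmod (f S))\<^sup>2)"
proof -
  let ?P = "Pow {..<d}"
  have "complex_of_real (\<Sum>X\<in>?P. (cmod (synth d f X))\<^sup>2)
      = (\<Sum>X\<in>?P. (\<Sum>S\<in>?P. chi S X * f S) * (\<Sum>T\<in>?P. chi T X * cnj (f T)))"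
    by (simp add: complex_norm_square synth_def del: of_real_power)
  also have "\<dots> = (\<Sum>X\<in>?P. \<Sum>S\<in>?P. \<Sum>T\<in>?P. (f S * cnj (f T)) * (chi S X * chi T X))"
    unfolding sum_product by (intro sum.cong refl) (simp add: mult_ac)
  also have "\<dots> = (\<Sum>S\<in>?P. \<Sum>T\<in>?P. \<Sum>X\<in>?P. (f S * cnj (f T)) * (chi S X * chi T X))"
    by (subst sum.swap, rule sum.cong[OF refl], rule sum.swap)
  also have "\<dots> = (\<Sum>S\<in>?P. \<Sum>T\<in>?P. (f S * cnj (f T)) * (if S = T then 2 ^ d else 0))"
    by (intro sum.cong refl) (simp add: sum_distrib_left[symmetric] chi_orthogonal del: Pow_iff)
  also have "\<dots> = (\<Sum>S\<in>?P. 2 ^ d * (f S * cnj (f S)))"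
    by (intro sum.cong refl) (simp add: if_distrib cong: if_cong)
  also have "\<dots> = complex_of_real (2 ^ d * (\<Sum>S\<in>?P. (cmod (f S))\<^sup>2))"
    by (simp add: complex_norm_square[symmetric] sum_distrib_left)
  finally show ?thesis using of_real_eq_iff by blast
qed

text \<open>The dictionary behind \<open>query_hat\<close>: an input-dependent sign on the function
  side is an input-independent relabelling on the coefficient side.\<close>

lemma synth_flip:
  assumes "j < d"
  shows "synth d (\<lambda>S. f (flip S j)) X = sgn_at X j * synth d f X"
proof -
  have "synth d (\<lambda>S. f (flip S j)) X = (\<Sum>S\<in>Pow {..<d}. chi (flip S j) X * f S)"
    unfolding synth_def
    using sum_flip[of "{..<d}" j "\<lambda>S. chi (flip S j) X * f S"] assms by simp
  also have "\<dots> = (\<Sum>S\<in>Pow {..<d}. sgn_at X j * (chi S X * f S))"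
  proof (intro sum.cong refl)
    fix S assume "S \<in> Pow {..<d}"
    then have "finite S" using finite_subset by auto
    then show "chi (flip S j) X * f S = sgn_at X j * (chi S X * f S)" by (simp add: chi_flip)
  qed
  finally show ?thesis by (simp add: synth_def sum_distrib_left)
qed

lemma synth_diff: "synth d (\<lambda>S. f S - g S) X = synth d f X - synth d g X"
  by (simp add: synth_def algebra_simps sum_subtractf)

lemma synth_cmult: "synth d (\<lambda>S. c * f S) X = c * synth d f X"
  by (simp add: synth_def sum_distrib_left mult_ac)

lemma synth_sum: "synth d (\<lambda>S. \<Sum>k\<in>I. f k S) X = (\<Sum>k\<in>I. synth d (f k) X)"
  unfolding synth_def sum_distrib_left by (rule sum.swap)

section \<open>Reflection oracles for phase states\<close>

text \<open>The oracle is \<open>1 - g g\<^sup>\<dagger>\<close> with \<open>g = |0>|0> - |1>|\<psi>>\<close>, where \<open>|1>|j>\<close> has index \<open>d + j\<close>. On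
  Fourier coefficients a sign at \<open>j\<close> becomes a flip of \<open>j\<close> in the label, which turns \<open>g\<^sup>\<dagger>\<close> into
  \<open>overlap\<close> and the query into \<open>query_hat\<close>.\<close>

definition overlap :: "(nat \<Rightarrow> complex) \<Rightarrow> nat \<Rightarrow> nat \<Rightarrow> (nat \<Rightarrow> nat set \<Rightarrow> complex) \<Rightarrow> nat \<Rightarrow> nat set \<Rightarrow> complex" where
  "overlap \<beta> d W h w S =
     h w S - (\<Sum>j<d. (cnj (\<beta> j) / sqrt d) * h ((d+j)*W+w) (flip S j))"

definition query_hat :: "(nat \<Rightarrow> complex) \<Rightarrow> nat \<Rightarrow> nat \<Rightarrow> (nat \<Rightarrow> nat set \<Rightarrow> complex) \<Rightarrow> nat \<Rightarrow> nat set \<Rightarrow> complex" where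
  "query_hat \<beta> d W h i S = h i S -
     (if i div W = 0 then overlap \<beta> d W h (i mod W) S
      else if d \<le> i div W \<and> i div W < 2*d
        then - (\<beta> (i div W - d) / sqrt d) * overlap \<beta> d W h (i mod W) (flip S (i div W - d))
      else 0)"

definition prep_vec :: "(nat \<Rightarrow> complex) \<Rightarrow> nat \<Rightarrow> nat set \<Rightarrow> complex vec" where
  "prep_vec \<beta> d X = vec (2*d*d) (\<lambda>a. if a = 0 then 1
     else if d \<le> a \<and> a < 2*d then - (\<beta> (a-d) / sqrt d) * sgn_at X (a-d) else 0)"

definition phase_oracle :: "(nat \<Rightarrow> complex) \<Rightarrow> nat \<Rightarrow> nat set \<Rightarrow> complex mat" where
  "phase_oracle \<beta> d X = 1\<^sub>m (2*d*d) - outer (prep_vec \<beta> d X)"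

definition phase_state :: "(nat \<Rightarrow> complex) \<Rightarrow> nat \<Rightarrow> nat set \<Rightarrow> complex vec" where
  "phase_state \<beta> d X = vec d (\<lambda>j. (\<beta> j / sqrt d) * sgn_at X j)"

text \<open>The positions \<open>0\<close> and \<open>d..<2*d\<close> are those on which the
  reflection vector lives. Stated for an arbitrary summand, since the commutator estimate later
  needs the same splitting.\<close>

lemma sum_split_prep:
  fixes F :: "nat \<Rightarrow> 'a::comm_monoid_add"
  assumes d: "d > 1" and z: "\<And>a. a \<noteq> 0 \<Longrightarrow> \<not> (d \<le> a \<and> a < 2*d) \<Longrightarrow> F a = 0"
  shows "(\<Sum>a<2*d*d. F a) = F 0 + (\<Sum>j<d. F (d+j))"
proof -
  have le: "2*d \<le> 2*d*d" using d by simp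
  have "(\<Sum>a<2*d*d. F a) = (\<Sum>a\<in>insert 0 {d..<2*d}. F a)"
    by (rule sum.mono_neutral_right) (use d le z in \<open>auto intro: less_le_trans\<close>)
  also have "\<dots> = F 0 + (\<Sum>a\<in>{d..<2*d}. F a)"
    using d by (subst sum.insert) auto
  also have "(\<Sum>a\<in>{d..<2*d}. F a) = (\<Sum>j<d. F (d+j))"
    by (rule sum.reindex_bij_witness[where i="\<lambda>j. d+j" and j="\<lambda>a. a-d"]) auto
  finally show ?thesis .
qed

lemma prep_vec_simps:
  assumes "d > 1"
  shows "prep_vec \<beta> d X $ 0 = 1"
    and "j < d \<Longrightarrow> prep_vec \<beta> d X $ (d+j) = - (\<beta> j / sqrt d) * sgn_at X j"
    and "a < 2*d*d \<Longrightarrow> a \<noteq> 0 \<Longrightarrow> \<not> (d \<le> a \<and> a < 2*d) \<Longrightarrow> prep_vec \<beta> d X $ a = 0"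
proof -
  have le: "2*d \<le> 2*d*d" using assms by simp
  show "prep_vec \<beta> d X $ 0 = 1" using assms by (simp add: prep_vec_def)
  show "prep_vec \<beta> d X $ (d+j) = - (\<beta> j / sqrt d) * sgn_at X j" if "j < d"
  proof -
    have "d + j < 2*d*d" using le that by linarith
    then show ?thesis using assms that by (simp add: prep_vec_def)
  qed
  show "prep_vec \<beta> d X $ a = 0" if "a < 2*d*d" "a \<noteq> 0" "\<not> (d \<le> a \<and> a < 2*d)"
    using that by (auto simp: prep_vec_def)
qed

text \<open>The parameter \<open>F\<close> lets one lemma serve both the conjugate, for inner
  products with the reflection vector, and the squared modulus, for its norm; \<open>F 0 = 0\<close>
  removes the positions off the support.\<close>

lemma sum_prep_vec:
  assumes d: "d > 1" and z: "F 0 = (0::'a::comm_ring_1)"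
  shows "(\<Sum>a<2*d*d. F (prep_vec \<beta> d X $ a) * g a)
       = F 1 * g 0 + (\<Sum>j<d. F (- (\<beta> j / sqrt d) * sgn_at X j) * g (d+j))"
proof -
  \<comment> \<open>The cut-off is needed because \<open>sum_split_prep\<close> asks for vanishing
    at every \<open>a\<close>, while vector entries beyond the dimension are unspecified.\<close>
  let ?G = "\<lambda>a. if a < 2*d*d then F (prep_vec \<beta> d X $ a) * g a else 0"
  have le: "d + j < 2*d*d" if "j < d" for j
  proof -
    have "d + j < 2*d*1" using that by simp
    also have "\<dots> \<le> 2*d*d" using d by (intro mult_left_mono) auto
    finally show ?thesis .
  qed
  have "(\<Sum>a<2*d*d. F (prep_vec \<beta> d X $ a) * g a) = (\<Sum>a<2*d*d. ?G a)" by simp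
  also have "\<dots> = ?G 0 + (\<Sum>j<d. ?G (d+j))"
    by (rule sum_split_prep[OF d]) (auto simp: prep_vec_simps[OF d] z)
  also have "\<dots> = F 1 * g 0 + (\<Sum>j<d. F (- (\<beta> j / sqrt d) * sgn_at X j) * g (d+j))"
    using d le by (simp add: prep_vec_simps[OF d])
  finally show ?thesis .
qed

text \<open>Squared norm 2: one unit from position \<open>0\<close> and \<open>d\<close> times
  \<open>1/d\<close> from the block. Hence subtracting the outer product, with no further factor, is
  a reflection.\<close>

lemma prep_vec_norm:
  assumes d: "d > 1" and b: "\<And>j. cmod (\<beta> j) = 1"
  shows "(\<Sum>a<2*d*d. prep_vec \<beta> d X $ a * cnj (prep_vec \<beta> d X $ a)) = 2"
proof -
  have "(\<Sum>a<2*d*d. prep_vec \<beta> d X $ a * cnj (prep_vec \<beta> d X $ a))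
     = (\<Sum>a<2*d*d. complex_of_real ((cmod (prep_vec \<beta> d X $ a))\<^sup>2) * 1)"
    by (simp add: complex_norm_square[symmetric] del: of_real_power)
  also have "\<dots> = 2"
    using d by (subst sum_prep_vec[OF d, where F="\<lambda>z. complex_of_real ((cmod z)\<^sup>2)"])
      (auto simp: norm_mult norm_divide b power_divide simp flip: of_real_power)
  finally show ?thesis .
qed

lemma oracle_entry:
  assumes "a < 2*d*d" "b < 2*d*d"
  shows "phase_oracle \<beta> d X $$ (a,b) = (if a = b then 1 else 0) - prep_vec \<beta> d X $ a * cnj (prep_vec \<beta> d X $ b)"
  using assms by (simp add: phase_oracle_def outer_def prep_vec_def)

lemma oracle_carrier: "phase_oracle \<beta> d X \<in> carrier_mat (2*d*d) (2*d*d)"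
  by (simp add: phase_oracle_def outer_def prep_vec_def carrier_matI)

text \<open>The oracle is Hermitian, so queries \<open>QU\<close> and \<open>QUdag\<close> act
  identically on it.\<close>

lemma adj_oracle: "adj (phase_oracle \<beta> d X) = phase_oracle \<beta> d X"
proof (rule eq_matI)
  fix i j assume ij: "i < dim_row (phase_oracle \<beta> d X)" "j < dim_col (phase_oracle \<beta> d X)"
  have "dim_row (phase_oracle \<beta> d X) = 2*d*d" "dim_col (phase_oracle \<beta> d X) = 2*d*d"
    using oracle_carrier by auto
  then show "adj (phase_oracle \<beta> d X) $$ (i, j) = phase_oracle \<beta> d X $$ (i, j)"
    using ij by (simp add: adj_def oracle_entry mult.commute)
qed (use oracle_carrier[of \<beta> d X] in auto)

text \<open>With \<open>g\<close> the reflection vector, the square of the oracle is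
  \<open>1\<close> minus twice the outer product of \<open>g\<close> plus the squared norm of
  \<open>g\<close> times that product; the squared norm 2 makes these cancel. The column relations
  follow from the row relations by Hermitian symmetry.\<close>

lemma oracle_unitary:
  assumes d: "d > 1" and b: "\<And>j. cmod (\<beta> j) = 1"
  shows "is_unitary (2*d*d) (phase_oracle \<beta> d X)"
proof -
  let ?n = "2*d*d" and ?U = "phase_oracle \<beta> d X" and ?g = "\<lambda>a. prep_vec \<beta> d X $ a"
  have norm: "(\<Sum>a<?n. ?g a * cnj (?g a)) = 2" by (rule prep_vec_norm[OF assms])
  have *: "(\<Sum>k<?n. ?U $$ (i,k) * cnj (?U $$ (j,k))) = (if i = j then 1 else 0)" if ij: "i < ?n" "j < ?n" for i j
  proof -
    have "(\<Sum>k<?n. ?U $$ (i,k) * cnj (?U $$ (j,k)))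
      = (\<Sum>k<?n. (if k = i then (if i = j then 1 else 0) else 0)
           - (if k = i then cnj (?g j) * ?g i else 0)
           - (if k = j then cnj (?g j) * ?g i else 0) + (?g i * cnj (?g j)) * (?g k * cnj (?g k)))"
      using ij by (intro sum.cong refl) (auto simp: oracle_entry algebra_simps)
    also have "\<dots> = (if i = j then 1 else 0) - cnj (?g j) * ?g i - cnj (?g j) * ?g i + (?g i * cnj (?g j)) * 2"
      using ij by (simp add: sum.distrib sum_subtractf sum_distrib_left[symmetric] norm)
    finally show ?thesis by (simp add: algebra_simps)
  qed
  have sym: "cnj (?U $$ (k,i)) = ?U $$ (i,k)" if "i < ?n" "k < ?n" for i k
    using that by (simp add: oracle_entry mult.commute)
  have "(\<Sum>k<?n. cnj (?U $$ (k,i)) * ?U $$ (k,j)) = (if i = j then 1 else 0)" if ij: "i < ?n" "j < ?n" for i j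
  proof -
    have "(\<Sum>k<?n. cnj (?U $$ (k,i)) * ?U $$ (k,j)) = (\<Sum>k<?n. ?U $$ (i,k) * cnj (?U $$ (j,k)))"
      using ij sym by (intro sum.cong refl arg_cong2[where f="(*)"]) auto
    then show ?thesis using * ij by simp
  qed
  then show ?thesis using * oracle_carrier by (simp add: is_unitary_iff)
qed

text \<open>Because entry \<open>0\<close> of the reflection vector is 1, column \<open>0\<close> of
  the oracle is the basis vector \<open>0\<close> minus that vector, which is |1>|psi>. Only the
  block \<open>k = 1\<close> then contributes to the partial trace.\<close>

lemma oracle_state_prep:
  assumes d: "d > 1" and b: "\<And>j. cmod (\<beta> j) = 1"
  shows "state_prep d (phase_state \<beta> d X) (phase_oracle \<beta> d X)"
proof -
  let ?n = "2*d*d"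
  define v where "v = phase_oracle \<beta> d X *\<^sub>v unit_vec ?n 0"
  have n: "?n > 0" using d by simp
  have v: "v $ a = (if a = 0 then 0 else - prep_vec \<beta> d X $ a)" if "a < ?n" for a
  proof -
    have "v $ a = (\<Sum>k<?n. phase_oracle \<beta> d X $$ (a,k) * unit_vec ?n 0 $ k)"
      unfolding v_def by (rule mult_vec_entry[OF oracle_carrier _ that]) simp
    also have "\<dots> = (\<Sum>k<?n. if k = 0 then phase_oracle \<beta> d X $$ (a,0) else 0)"
      by (intro sum.cong refl) (auto simp: unit_vec_def)
    finally show ?thesis using that n by (simp add: oracle_entry prep_vec_simps[OF d])
  qed
  have v0: "v $ i = 0" if "i < d" for i
  proof -
    have "i < ?n" using that d by (simp add: less_le_trans)
    then show ?thesis using that by (simp add: v prep_vec_simps[OF d])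
  qed
  have v1: "v $ (d+i) = phase_state \<beta> d X $ i" if "i < d" for i
  proof -
    have "d + i < 2*d*1" using that by simp
    also have "\<dots> \<le> ?n" using d by (intro mult_left_mono) auto
    finally show ?thesis using that d by (simp add: v prep_vec_simps[OF d] phase_state_def)
  qed
  have v2: "v $ (k*d+i) = 0" if "i < d" "k < 2*d" "k \<noteq> 1" for i k
  proof (cases "k = 0")
    case True then show ?thesis using v0 that by simp
  next
    case False
    have "2*d \<le> k*d + i" using False that by (metis One_nat_def Suc_1 Suc_leI le_add1 le_neq_implies_less le_trans less_one mult_le_mono1 not_less)
    moreover have "k*d+i < ?n" by (rule pair_index_less) (use that in auto)
    ultimately show ?thesis using d by (simp add: v prep_vec_simps[OF d])
  qed
  have dimv: "dim_vec v = ?n" unfolding v_def using oracle_carrier[of \<beta> d X] by auto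
  have "ptrace_A (2*d) d (outer v) = outer (phase_state \<beta> d X)"
  proof (rule eq_matI)
    fix i j assume "i < dim_row (outer (phase_state \<beta> d X))" "j < dim_col (outer (phase_state \<beta> d X))"
    then have ij: "i < d" "j < d" by (auto simp: outer_def phase_state_def)
    have "ptrace_A (2*d) d (outer v) $$ (i,j) = (\<Sum>k<2*d. v $ (k*d+i) * cnj (v $ (k*d+j)))"
      using ij pair_index_less[of _ "2*d" _ d] by (simp add: ptrace_A_def outer_def dimv)
    also have "\<dots> = (\<Sum>k<2*d. if k = 1 then v $ (d+i) * cnj (v $ (d+j)) else 0)"
      using ij v2 by (intro sum.cong refl) auto
    also have "\<dots> = outer (phase_state \<beta> d X) $$ (i,j)"
      using ij d by (simp add: v1 outer_def phase_state_def)
    finally show "ptrace_A (2*d) d (outer v) $$ (i,j) = outer (phase_state \<beta> d X) $$ (i,j)" .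
  qed (auto simp: ptrace_A_def outer_def phase_state_def)
  then show ?thesis using oracle_unitary[OF assms] by (simp add: state_prep_def v_def)
qed

lemma phase_state_pure:
  assumes d: "d > 0" and b: "\<And>j. cmod (\<beta> j) = 1"
  shows "is_pure_state d (phase_state \<beta> d X)"
  using d by (simp add: is_pure_state_def phase_state_def norm_mult norm_divide b power_divide)

text \<open>The signs square to 1, so the realness is the same for every \<open>X\<close>. This
  permits averaging over all sign patterns.\<close>

lemma realness_phase_state:
  assumes d: "d > 0"
  shows "realness d (phase_state \<beta> d X) = (cmod (\<Sum>j<d. (\<beta> j)\<^sup>2) / d)\<^sup>2"
proof -
  have "(\<Sum>i<d. (phase_state \<beta> d X $ i)\<^sup>2) = (\<Sum>j<d. (\<beta> j)\<^sup>2 / d)"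
  proof (intro sum.cong refl)
    fix i assume "i \<in> {..<d}"
    have "(sgn_at X i)\<^sup>2 = 1" by (simp add: power2_eq_square)
    moreover have "(complex_of_real (sqrt d))\<^sup>2 = d" by (simp flip: of_real_power)
    ultimately show "(phase_state \<beta> d X $ i)\<^sup>2 = (\<beta> i)\<^sup>2 / d"
      using \<open>i \<in> {..<d}\<close> by (simp add: phase_state_def power_mult_distrib power_divide)
  qed
  also have "\<dots> = (\<Sum>j<d. (\<beta> j)\<^sup>2) / d" by (simp add: sum_divide_distrib)
  finally show ?thesis by (simp add: realness_def norm_divide)
qed

section \<open>Queries on the Fourier side\<close>

lemma synth_overlap:
  assumes d: "d > 1"
  shows "synth d (overlap \<beta> d W h w) X
       = (\<Sum>b<2*d*d. cnj (prep_vec \<beta> d X $ b) * synth d (h (b*W+w)) X)"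
proof -
  have "synth d (overlap \<beta> d W h w) X = synth d (h w) X -
      (\<Sum>j<d. (cnj (\<beta> j) / sqrt d) * (sgn_at X j * synth d (h ((d+j)*W+w)) X))"
    unfolding overlap_def synth_diff synth_sum synth_cmult
    by (intro arg_cong2[where f="(-)"] sum.cong refl) (simp add: synth_flip)
  also have "\<dots> = (\<Sum>b<2*d*d. cnj (prep_vec \<beta> d X $ b) * synth d (h (b*W+w)) X)"
    by (subst sum_prep_vec[OF d, where F=cnj]) (simp_all add: sum_negf mult_ac)
  finally show ?thesis .
qed

text \<open>The coefficient map \<open>query_hat\<close> reproduces the reflection for every
  \<open>X\<close> simultaneously. The three cases are the three kinds of entries of
  \<open>prep_vec\<close>; only in the block \<open>d..<2*d\<close> does the entry carry a sign and
  hence cause a flip.\<close>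

lemma synth_query_hat:
  assumes d: "d > 1" and i: "i < 2*d*d*W"
  shows "synth d (query_hat \<beta> d W h i) X
       = synth d (h i) X - prep_vec \<beta> d X $ (i div W) * synth d (overlap \<beta> d W h (i mod W)) X"
proof -
  have i': "i div W < 2*d*d" using i by (simp add: less_mult_imp_div_less)
  consider "i div W = 0" | j where "j < d" "i div W = d + j"
    | "i div W \<noteq> 0" "\<not> (d \<le> i div W \<and> i div W < 2*d)"
  proof (cases "d \<le> i div W \<and> i div W < 2*d")
    case True
    then have "i div W - d < d" "i div W = d + (i div W - d)" by auto
    then show ?thesis using that by blast
  qed (use that in blast)
  then show ?thesis
  proof cases
    case 1
    then have "query_hat \<beta> d W h i = (\<lambda>S. h i S - overlap \<beta> d W h (i mod W) S)"
      by (intro ext) (simp add: query_hat_def)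
    then show ?thesis using 1 by (simp add: synth_diff prep_vec_simps[OF d])
  next
    case 2
    then have "query_hat \<beta> d W h i =
      (\<lambda>S. h i S - (- (\<beta> j / sqrt d)) * overlap \<beta> d W h (i mod W) (flip S j))"
      using d by (intro ext) (simp add: query_hat_def)
    then have "synth d (query_hat \<beta> d W h i) X = synth d (h i) X -
        (- (\<beta> j / sqrt d)) * (sgn_at X j * synth d (overlap \<beta> d W h (i mod W)) X)"
      using synth_flip[OF 2(1), of "overlap \<beta> d W h (i mod W)" X]
      by (simp only: synth_diff synth_cmult)
    then show ?thesis using 2 by (simp add: prep_vec_simps(2)[OF d])
  next
    case 3
    then have "query_hat \<beta> d W h i = h i"
      by (intro ext) (auto simp: query_hat_def)
    then show ?thesis using 3 i' by (simp add: prep_vec_simps(3)[OF d])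
  qed
qed

lemma query_op_carrier:
  assumes "U \<in> carrier_mat n n"
  shows "query_op q U W \<in> carrier_mat (n*W) (n*W)"
proof -
  have "conj_mat U \<in> carrier_mat n n" using assms by (simp add: conj_mat_def)
  then show ?thesis unfolding query_op_def
    by (intro kron_carrier) (use assms adj_carrier in \<open>auto split: query.splits\<close>)
qed

lemma query_op_entry:
  assumes q: "q \<in> {QU, QUdag}" and v: "v \<in> carrier_vec (2*d*d*W)" and i: "i < 2*d*d*W"
  shows "(query_op q (phase_oracle \<beta> d X) W *\<^sub>v v) $ i
       = v $ i - prep_vec \<beta> d X $ (i div W) *
           (\<Sum>b<2*d*d. cnj (prep_vec \<beta> d X $ b) * v $ (b*W + i mod W))"
proof -
  let ?n = "2*d*d" and ?U = "phase_oracle \<beta> d X" and ?g = "\<lambda>a. prep_vec \<beta> d X $ a"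
  obtain a w where aw: "a < ?n" "w < W" "i = a*W+w" using i by (rule index_decompose)
  have Q: "query_op q ?U W = kron ?U (1\<^sub>m W)" using q by (auto simp: query_op_def adj_oracle)
  have "(query_op q ?U W *\<^sub>v v) $ i = (\<Sum>k<?n*W. kron ?U (1\<^sub>m W) $$ (i,k) * v $ k)"
    unfolding Q by (rule mult_vec_entry[OF kron_carrier[OF oracle_carrier one_carrier_mat] v i])
  also have "\<dots> = (\<Sum>b<?n. \<Sum>w'<W. kron ?U (1\<^sub>m W) $$ (i,b*W+w') * v $ (b*W+w'))"
    by (rule sum_mult_index)
  also have "\<dots> = (\<Sum>b<?n. \<Sum>w'<W. if w' = w then ?U $$ (a,b) * v $ (b*W+w) else 0)"
    using aw by (intro sum.cong refl) (auto simp: kron_entry[OF oracle_carrier one_carrier_mat])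
  also have "\<dots> = (\<Sum>b<?n. ?U $$ (a,b) * v $ (b*W+w))" using aw by simp
  also have "\<dots> = (\<Sum>b<?n. (if b = a then v $ (a*W+w) else 0) - ?g a * (cnj (?g b) * v $ (b*W+w)))"
    using aw by (intro sum.cong refl) (auto simp: oracle_entry algebra_simps)
  also have "\<dots> = v $ (a*W+w) - ?g a * (\<Sum>b<?n. cnj (?g b) * v $ (b*W+w))"
    using aw by (simp add: sum_subtractf sum_distrib_left)
  finally show ?thesis using aw by simp
qed

text \<open>The coefficients \<open>h\<close> do not depend on \<open>X\<close>: one application of
  \<open>query_hat\<close> describes the query for all sign patterns.\<close>

lemma query_op_synth:
  assumes d: "d > 1" and q: "q \<in> {QU, QUdag}" and i: "i < 2*d*d*W"
    and v: "v \<in> carrier_vec (2*d*d*W)" "\<And>k. k < 2*d*d*W \<Longrightarrow> v $ k = synth d (h k) X"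
  shows "(query_op q (phase_oracle \<beta> d X) W *\<^sub>v v) $ i = synth d (query_hat \<beta> d W h i) X"
proof -
  have "W > 0" using i by (cases W) auto
  then have "b*W + i mod W < 2*d*d*W" if "b < 2*d*d" for b
    using that by (intro pair_index_less) auto
  then show ?thesis
    unfolding synth_query_hat[OF d i] synth_overlap[OF d] query_op_entry[OF q v(1) i]
    using v(2) i by simp
qed

section \<open>Norm of the coefficients and its invariance under queries\<close>

definition nrm2 :: "nat \<Rightarrow> nat \<Rightarrow> (nat \<Rightarrow> nat set \<Rightarrow> complex) \<Rightarrow> real" where
  "nrm2 N d h = (\<Sum>i<N. \<Sum>S\<in>Pow {..<d}. (cmod (h i S))\<^sup>2)"

text \<open>Obtained without computing with \<open>query_hat\<close>: by Parseval the norm is the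
  average over \<open>X\<close> of the squared norms of the actual states, and each actual query is
  unitary.\<close>

lemma nrm2_query_hat:
  assumes d: "d > 1" and b: "\<And>j. cmod (\<beta> j) = 1"
  shows "nrm2 (2*d*d*W) d (query_hat \<beta> d W h) = nrm2 (2*d*d*W) d h"
proof -
  let ?N = "2*d*d*W" and ?P = "Pow {..<d}"
  define v where "v X = vec ?N (\<lambda>i. synth d (h i) X)" for X
  let ?Q = "\<lambda>X. query_op QU (phase_oracle \<beta> d X) W"
  have uni: "is_unitary ?N (?Q X)" for X
    using kron_unitary[OF oracle_unitary[OF assms] one_unitary] by (simp add: query_op_def)
  have par: "2^d * nrm2 ?N d f = (\<Sum>X\<in>?P. \<Sum>i<?N. (cmod (synth d (f i) X))\<^sup>2)" for f
    unfolding nrm2_def by (subst sum.swap) (simp add: parseval sum_distrib_left del: Pow_iff)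
  have "2^d * nrm2 ?N d (query_hat \<beta> d W h) = (\<Sum>X\<in>?P. \<Sum>i<?N. (cmod (synth d (query_hat \<beta> d W h i) X))\<^sup>2)"
    by (rule par)
  also have "\<dots> = (\<Sum>X\<in>?P. \<Sum>i<?N. (cmod (\<Sum>k<?N. ?Q X $$ (i,k) * synth d (h k) X))\<^sup>2)"
  proof (intro sum.cong refl)
    fix X i assume i: "i \<in> {..<?N}"
    have "synth d (query_hat \<beta> d W h i) X = (?Q X *\<^sub>v v X) $ i"
      by (rule query_op_synth[OF d, symmetric]) (use i in \<open>auto simp: v_def\<close>)
    also have "\<dots> = (\<Sum>k<?N. ?Q X $$ (i,k) * v X $ k)"
      by (rule mult_vec_entry[OF query_op_carrier[OF oracle_carrier]]) (use i in \<open>auto simp: v_def\<close>)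
    finally show "(cmod (synth d (query_hat \<beta> d W h i) X))\<^sup>2
        = (cmod (\<Sum>k<?N. ?Q X $$ (i,k) * synth d (h k) X))\<^sup>2" by (simp add: v_def)
  qed
  also have "\<dots> = 2^d * nrm2 ?N d h"
    unfolding par unitary_sum_norm[OF uni] ..
  finally show ?thesis by simp
qed

section \<open>Twisting by phases and its commutator with a query\<close>

definition phase :: "(nat \<Rightarrow> complex) \<Rightarrow> nat set \<Rightarrow> complex" where
  "phase \<beta> S = (\<Prod>j\<in>S. \<beta> j)"

definition twist :: "(nat \<Rightarrow> complex) \<Rightarrow> (nat \<Rightarrow> nat set \<Rightarrow> complex) \<Rightarrow> nat \<Rightarrow> nat set \<Rightarrow> complex" where
  "twist \<beta> h i S = phase \<beta> S * h i S"

lemma cmod_phase: "(\<And>j. cmod (\<beta> j) = 1) \<Longrightarrow> cmod (phase \<beta> S) = 1"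
  by (simp add: phase_def prod_norm[symmetric])

text \<open>The transition in which \<open>j\<close> enters the label with weight
  \<open>\<beta> j\<close>: the twist absorbs this weight exactly.\<close>

lemma phase_flip_in:
  assumes "finite S" "j \<in> S"
  shows "\<beta> j * phase \<beta> (flip S j) = phase \<beta> S"
  using assms by (simp add: phase_def flip_def prod.remove[of S j])

text \<open>The companion case: \<open>j\<close> leaves the label, and the weight absorbed is the
  conjugate of \<open>\<beta> j\<close>.\<close>

lemma phase_flip_notin:
  assumes "finite S" "j \<notin> S" "cmod (\<beta> j) = 1"
  shows "cnj (\<beta> j) * phase \<beta> (flip S j) = phase \<beta> S"
proof -
  have "\<beta> j * cnj (\<beta> j) = 1" using assms(3) by (simp add: complex_norm_square[symmetric])
  then show ?thesis using assms(1,2) by (simp add: phase_def flip_def algebra_simps)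
qed

lemma card_flip: "finite S \<Longrightarrow> card S \<le> Suc (card (flip S j))"
  by (auto simp: flip_def card_insert_if intro: card_insert_le)

lemma sum_square_le:
  fixes f :: "'a \<Rightarrow> real"
  shows "(\<Sum>i\<in>I. f i)\<^sup>2 \<le> card I * (\<Sum>i\<in>I. (f i)\<^sup>2)"
proof -
  have "\<bar>\<Sum>i\<in>I. f i\<bar> \<le> (\<Sum>i\<in>I. \<bar>1\<bar> * \<bar>f i\<bar>)" by simp
  also have "\<dots> \<le> L2_set (\<lambda>_. 1) I * L2_set f I" by (rule L2_set_mult_ineq)
  finally have "\<bar>\<Sum>i\<in>I. f i\<bar>\<^sup>2 \<le> (L2_set (\<lambda>_. 1) I * L2_set f I)\<^sup>2"
    by (rule power_mono) simp
  then show ?thesis by (simp add: power_mult_distrib L2_set_def sum_nonneg)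
qed

text \<open>Each term of the overlap moves the label by at most one element, so coefficients living
  on sizes up to \<open>K\<close> give an overlap on sizes up to \<open>K + 1\<close>.\<close>

lemma overlap_support:
  assumes S: "finite S" "card S > Suc K" and w: "w < W" and d: "d > 1"
    and supp: "\<And>i T. i < 2*d*d*W \<Longrightarrow> finite T \<Longrightarrow> card T > K \<Longrightarrow> h i T = 0"
  shows "overlap \<beta> d W h w S = 0"
proof -
  have "h w S = 0"
    using pair_index_less[of 0 "2*d*d" w W] w d S by (intro supp) auto
  moreover have "h ((d+j)*W+w) (flip S j) = 0" if "j < d" for j
  proof (rule supp)
    have "d + j < 2*d*1" using that by simp
    also have "\<dots> \<le> 2*d*d" using d by (intro mult_left_mono) auto
    finally show "(d+j)*W+w < 2*d*d*W" using w by (rule pair_index_less)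
    show "finite (flip S j)" using S by (simp add: flip_def)
    show "card (flip S j) > K" using card_flip[of S j] S by simp
  qed
  ultimately show ?thesis by (simp add: overlap_def)
qed

text \<open>One element from the overlap and one from writing it back into the block
  \<open>d..<2*d\<close>: a query raises the label size by at most two.\<close>

lemma query_hat_support:
  assumes S: "finite S" "card S > K + 2" and i: "i < 2*d*d*W" and d: "d > 1"
    and supp: "\<And>i T. i < 2*d*d*W \<Longrightarrow> finite T \<Longrightarrow> card T > K \<Longrightarrow> h i T = 0"
  shows "query_hat \<beta> d W h i S = 0"
proof -
  have "W > 0" using i by (cases W) auto
  then have w: "i mod W < W" by simp
  have o: "overlap \<beta> d W h (i mod W) T = 0" if "finite T" "card T > Suc K" for T
    using that w d supp by (rule overlap_support)
  have "overlap \<beta> d W h (i mod W) (flip S j) = 0" for j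
    using card_flip[of S j] S by (intro o) (auto simp: flip_def)
  moreover have "overlap \<beta> d W h (i mod W) S = 0" using S by (intro o) auto
  moreover have "h i S = 0" using S i by (intro supp) auto
  ultimately show ?thesis by (simp add: query_hat_def)
qed

text \<open>Terms with \<open>j\<close> outside \<open>S\<close> cancel by
  \<open>phase_flip_notin\<close>. At most \<open>K + 1\<close> terms remain, each with a factor of
  modulus at most \<open>2 / sqrt d\<close>, so Cauchy-Schwarz gives \<open>4 * (K + 1) / d\<close>.
  Summed over \<open>S\<close>, the flip is a bijection of the labels and disappears.\<close>

lemma overlap_twist_bound:
  assumes d: "d > 1" and w: "w < W" and b: "\<And>j. cmod (\<beta> j) = 1"
    and supp: "\<And>i T. i < 2*d*d*W \<Longrightarrow> finite T \<Longrightarrow> card T > K \<Longrightarrow> h i T = 0"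
  shows "(\<Sum>S\<in>Pow {..<d}. (cmod (overlap \<beta> d W (twist \<beta> h) w S - phase \<beta> S * overlap (\<lambda>_. 1) d W h w S))\<^sup>2)
    \<le> 4 * (real K + 1) / d * (\<Sum>j<d. \<Sum>S\<in>Pow {..<d}. (cmod (h ((d+j)*W+w) S))\<^sup>2)"
proof -
  let ?D = "\<lambda>S. overlap \<beta> d W (twist \<beta> h) w S - phase \<beta> S * overlap (\<lambda>_. 1) d W h w S"
  let ?h = "\<lambda>j S. h ((d+j)*W+w) S"
  have bnd: "(cmod (?D S))\<^sup>2 \<le> (4 * (real K + 1) / d) * (\<Sum>j<d. (cmod (?h j (flip S j)))\<^sup>2)"
    if S: "S \<in> Pow {..<d}" for S
  proof (cases "card S > Suc K")
    case True
    have fS: "finite S" using S finite_subset by auto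
    have "overlap \<beta> d W (twist \<beta> h) w S = 0"
      by (rule overlap_support[OF fS True w d]) (simp add: twist_def supp)
    moreover have "overlap (\<lambda>_. 1) d W h w S = 0"
      by (rule overlap_support[OF fS True w d]) (simp add: supp)
    ultimately show ?thesis by (simp add: sum_nonneg)
  next
    case False
    have fS: "finite S" using S finite_subset by auto
    \<comment> \<open>The mismatch between the phase required at \<open>S\<close> and the one
      produced by the transition from \<open>flip S j\<close>; it can be nonzero only when
      \<open>j\<close> entered the label with a conjugate weight.\<close>
    let ?c = "\<lambda>j. (phase \<beta> S - cnj (\<beta> j) * phase \<beta> (flip S j)) / sqrt d * ?h j (flip S j)"
    have c0: "?c j = 0" if "j \<notin> S" for j
      using phase_flip_notin[OF fS that, of \<beta>] b by simp
    have c: "cmod (?c j) \<le> 2 / sqrt d * cmod (?h j (flip S j))" for j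
    proof -
      have "cmod (phase \<beta> S - cnj (\<beta> j) * phase \<beta> (flip S j)) \<le> 2"
        using norm_triangle_ineq4[of "phase \<beta> S" "cnj (\<beta> j) * phase \<beta> (flip S j)"]
        by (simp add: norm_mult cmod_phase b)
      then show ?thesis by (auto simp: norm_mult norm_divide intro!: mult_right_mono divide_right_mono)
    qed
    have "(\<Sum>j<d. ?c j) = (\<Sum>j<d. phase \<beta> S * (cnj 1 / sqrt d * ?h j (flip S j)))
        - (\<Sum>j<d. cnj (\<beta> j) / sqrt d * (phase \<beta> (flip S j) * ?h j (flip S j)))"
      unfolding sum_subtractf[symmetric]
      by (intro sum.cong refl) (simp add: algebra_simps diff_divide_distrib)
    then have "?D S = (\<Sum>j<d. ?c j)"
      unfolding overlap_def twist_def right_diff_distrib sum_distrib_left by simp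
    also have "\<dots> = (\<Sum>j\<in>S. ?c j)"
      by (rule sum.mono_neutral_right) (use S c0 in auto)
    finally have "cmod (?D S) = cmod (\<Sum>j\<in>S. ?c j)" by (rule arg_cong)
    also have "\<dots> \<le> (\<Sum>j\<in>S. 2 / sqrt d * cmod (?h j (flip S j)))"
      using c by (rule sum_norm_le)
    finally have "cmod (?D S) \<le> (\<Sum>j\<in>S. 2 / sqrt d * cmod (?h j (flip S j)))" .
    then have "(cmod (?D S))\<^sup>2 \<le> (\<Sum>j\<in>S. 2 / sqrt d * cmod (?h j (flip S j)))\<^sup>2"
      by (intro power_mono) auto
    also have "\<dots> \<le> card S * (\<Sum>j\<in>S. (2 / sqrt d * cmod (?h j (flip S j)))\<^sup>2)"
      by (rule sum_square_le)
    also have "\<dots> = card S * (4 / d) * (\<Sum>j\<in>S. (cmod (?h j (flip S j)))\<^sup>2)"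
      by (simp add: power_mult_distrib power_divide sum_distrib_left mult_ac)
    also have "\<dots> \<le> (real K + 1) * (4 / d) * (\<Sum>j<d. (cmod (?h j (flip S j)))\<^sup>2)"
      using False S by (intro mult_mono sum_mono2) (auto intro: sum_nonneg)
    finally show ?thesis by (simp add: mult_ac)
  qed
  have "(\<Sum>S\<in>Pow {..<d}. (cmod (?D S))\<^sup>2)
      \<le> (\<Sum>S\<in>Pow {..<d}. (4 * (real K + 1) / d) * (\<Sum>j<d. (cmod (?h j (flip S j)))\<^sup>2))"
    by (rule sum_mono) (rule bnd)
  also have "\<dots> = (4 * (real K + 1) / d) * (\<Sum>j<d. \<Sum>S\<in>Pow {..<d}. (cmod (?h j (flip S j)))\<^sup>2)"
    by (subst sum.swap) (simp add: sum_distrib_left)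
  also have "(\<Sum>j<d. \<Sum>S\<in>Pow {..<d}. (cmod (?h j (flip S j)))\<^sup>2) = (\<Sum>j<d. \<Sum>S\<in>Pow {..<d}. (cmod (?h j S))\<^sup>2)"
    by (intro sum.cong refl sum_flip) auto
  finally show ?thesis .
qed

lemma cmod_add_square_le: "(cmod (x + y))\<^sup>2 \<le> 2 * (cmod x)\<^sup>2 + 2 * (cmod y)\<^sup>2"
proof -
  have "(cmod (x + y))\<^sup>2 \<le> (cmod x + cmod y)\<^sup>2"
    by (intro power_mono norm_triangle_ineq) simp
  also have "\<dots> \<le> 2 * (cmod x)\<^sup>2 + 2 * (cmod y)\<^sup>2"
    using zero_le_power2[of "cmod x - cmod y"] by (simp add: power2_sum power2_diff)
  finally show ?thesis .
qed

text \<open>A crude bound valid for all labels: Cauchy-Schwarz over \<open>d\<close> terms costs a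
  factor \<open>d\<close>, which the squared weights \<open>1/d\<close> cancel; the 2 comes from
  \<open>cmod_add_square_le\<close>.\<close>

lemma overlap_bound:
  assumes d: "d > 1" and b: "\<And>j. cmod (\<beta> j) = 1"
  shows "(\<Sum>S\<in>Pow {..<d}. (cmod (overlap \<beta> d W h w S))\<^sup>2)
    \<le> 2 * ((\<Sum>S\<in>Pow {..<d}. (cmod (h w S))\<^sup>2) + (\<Sum>j<d. \<Sum>S\<in>Pow {..<d}. (cmod (h ((d+j)*W+w) S))\<^sup>2))"
proof -
  let ?h = "\<lambda>j S. h ((d+j)*W+w) S"
  have bnd: "(cmod (overlap \<beta> d W h w S))\<^sup>2 \<le> 2 * (cmod (h w S))\<^sup>2 + 2 * (\<Sum>j<d. (cmod (?h j (flip S j)))\<^sup>2)" for S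
  proof -
    let ?x = "\<Sum>j<d. (cnj (\<beta> j) / sqrt d) * ?h j (flip S j)"
    have "(cmod ?x)\<^sup>2 \<le> (\<Sum>j<d. cmod ((cnj (\<beta> j) / sqrt d) * ?h j (flip S j)))\<^sup>2"
      by (intro power_mono norm_sum) simp
    also have "\<dots> \<le> card {..<d} * (\<Sum>j<d. (cmod ((cnj (\<beta> j) / sqrt d) * ?h j (flip S j)))\<^sup>2)"
      by (rule sum_square_le)
    also have "\<dots> = (\<Sum>j<d. (cmod (?h j (flip S j)))\<^sup>2)"
      using d by (simp add: norm_mult norm_divide b power_mult_distrib power_divide sum_distrib_left)
    finally show ?thesis
      using cmod_add_square_le[of "h w S" "- ?x"] by (simp add: overlap_def)
  qed
  have "(\<Sum>S\<in>Pow {..<d}. (cmod (overlap \<beta> d W h w S))\<^sup>2)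
     \<le> (\<Sum>S\<in>Pow {..<d}. 2 * (cmod (h w S))\<^sup>2 + 2 * (\<Sum>j<d. (cmod (?h j (flip S j)))\<^sup>2))"
    by (rule sum_mono) (rule bnd)
  also have "\<dots> = 2 * ((\<Sum>S\<in>Pow {..<d}. (cmod (h w S))\<^sup>2) + (\<Sum>j<d. \<Sum>S\<in>Pow {..<d}. (cmod (?h j (flip S j)))\<^sup>2))"
    by (subst sum.swap) (simp add: sum.distrib sum_distrib_left distrib_left)
  also have "(\<Sum>j<d. \<Sum>S\<in>Pow {..<d}. (cmod (?h j (flip S j)))\<^sup>2) = (\<Sum>j<d. \<Sum>S\<in>Pow {..<d}. (cmod (?h j S))\<^sup>2)"
    by (intro sum.cong refl sum_flip) auto
  finally show ?thesis .
qed

text \<open>The failure of the twist to carry the query for the constant 1 into the query for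
  \<open>\<beta>\<close>.\<close>

definition commutator :: "(nat \<Rightarrow> complex) \<Rightarrow> nat \<Rightarrow> nat \<Rightarrow> (nat \<Rightarrow> nat set \<Rightarrow> complex) \<Rightarrow> nat \<Rightarrow> nat set \<Rightarrow> complex" where
  "commutator \<beta> d W h i S = query_hat \<beta> d W (twist \<beta> h) i S - twist \<beta> (query_hat (\<lambda>_. 1) d W h) i S"

lemma commutator_flag_bound:
  assumes d: "d > 1" and w: "w < W" and b: "\<And>j. cmod (\<beta> j) = 1"
    and supp: "\<And>i T. i < 2*d*d*W \<Longrightarrow> finite T \<Longrightarrow> card T > K \<Longrightarrow> h i T = 0"
  shows "(\<Sum>S\<in>Pow {..<d}. (cmod (commutator \<beta> d W h w S))\<^sup>2) +
         (\<Sum>j<d. \<Sum>S\<in>Pow {..<d}. (cmod (commutator \<beta> d W h ((d+j)*W+w) S))\<^sup>2)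
    \<le> 28 * (real K + 1) / d * ((\<Sum>S\<in>Pow {..<d}. (cmod (h w S))\<^sup>2) +
         (\<Sum>j<d. \<Sum>S\<in>Pow {..<d}. (cmod (h ((d+j)*W+w) S))\<^sup>2))" (is "?C0 + ?C1 \<le> _ * (?E0 + ?E1)")
proof -
  let ?P = "Pow {..<d}"
  let ?u = "\<lambda>S. overlap (\<lambda>_. 1) d W h w S"
  define D where "D S = overlap \<beta> d W (twist \<beta> h) w S - phase \<beta> S * ?u S" for S
  have DD: "(\<Sum>S\<in>?P. (cmod (D S))\<^sup>2) \<le> 4 * (real K + 1) / d * ?E1"
    unfolding D_def by (rule overlap_twist_bound[OF assms])
  have E: "?E0 \<ge> 0" "?E1 \<ge> 0" by (auto intro!: sum_nonneg)
  have C0: "commutator \<beta> d W h w S = - D S" for S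
    using w by (simp add: commutator_def query_hat_def twist_def D_def algebra_simps)
  \<comment> \<open>Splits the commutator into the right weight applied to the defect
    \<open>D\<close> plus the phase mismatch of the write-back applied to the undisturbed
    overlap.\<close>
  have C1: "commutator \<beta> d W h ((d+j)*W+w) S = \<beta> j / sqrt d * D (flip S j)
      + (\<beta> j * phase \<beta> (flip S j) - phase \<beta> S) / sqrt d * ?u (flip S j)" if "j < d" for j S
  proof -
    have dm: "((d+j)*W+w) div W = d + j" "((d+j)*W+w) mod W = w" using w by auto
    show ?thesis using that d unfolding commutator_def query_hat_def twist_def D_def dm
      by (simp add: algebra_simps diff_divide_distrib)
  qed
  have u: "?u S = 0" if "S \<in> ?P" "card S > Suc K" for S
    by (rule overlap_support[OF _ that(2) w d]) (use that finite_subset supp in auto)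
  have "?C1 \<le> (\<Sum>j<d. \<Sum>S\<in>?P. 2/d * (cmod (D (flip S j)))\<^sup>2 + (if j \<in> flip S j then 8/d * (cmod (?u (flip S j)))\<^sup>2 else 0))"
  proof (intro sum_mono)
    fix j S assume j: "j \<in> {..<d}" and S: "S \<in> ?P"
    have fS: "finite S" using S finite_subset by auto
    let ?k = "\<beta> j * phase \<beta> (flip S j) - phase \<beta> S"
    have k2: "cmod ?k \<le> 2"
      using norm_triangle_ineq4[of "\<beta> j * phase \<beta> (flip S j)" "phase \<beta> S"]
      by (simp add: norm_mult cmod_phase b)
    \<comment> \<open>By \<open>phase_flip_in\<close> the mismatch vanishes when \<open>j\<close>
      enters the label; it survives only when \<open>j\<close> leaves, that is, when
      \<open>j\<close> belongs to the source label \<open>flip S j\<close>.\<close>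
    have k: "(cmod ?k)\<^sup>2 \<le> (if j \<in> flip S j then 4 else 0)"
    proof (cases "j \<in> S")
      case True then show ?thesis using phase_flip_in[OF fS True] by (simp add: flip_def)
    next
      case False then show ?thesis using power_mono[OF k2, of 2] by (simp add: flip_def)
    qed
    have "(cmod (commutator \<beta> d W h ((d+j)*W+w) S))\<^sup>2
       \<le> 2 * (cmod (\<beta> j / sqrt d * D (flip S j)))\<^sup>2 + 2 * (cmod (?k / sqrt d * ?u (flip S j)))\<^sup>2"
      using j by (subst C1) (auto intro: cmod_add_square_le)
    also have "\<dots> = 2/d * (cmod (D (flip S j)))\<^sup>2 + 2/d * ((cmod ?k)\<^sup>2 * (cmod (?u (flip S j)))\<^sup>2)"
      by (simp add: norm_mult norm_divide b power_mult_distrib power_divide)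
    also have "\<dots> \<le> 2/d * (cmod (D (flip S j)))\<^sup>2 + 2/d * ((if j \<in> flip S j then 4 else 0) * (cmod (?u (flip S j)))\<^sup>2)"
      by (intro add_mono mult_left_mono mult_right_mono k) auto
    finally show "(cmod (commutator \<beta> d W h ((d+j)*W+w) S))\<^sup>2 \<le>
      2/d * (cmod (D (flip S j)))\<^sup>2 + (if j \<in> flip S j then 8/d * (cmod (?u (flip S j)))\<^sup>2 else 0)"
      by (auto split: if_splits)
  qed
  \<comment> \<open>Passing to the source label makes the surviving condition
    \<open>j \<in> S\<close>, so that for fixed \<open>S\<close> the sum over \<open>j\<close>
    merely counts elements of \<open>S\<close>.\<close>
  also have "\<dots> = (\<Sum>j<d. \<Sum>S\<in>?P. 2/d * (cmod (D S))\<^sup>2 + (if j \<in> S then 8/d * (cmod (?u S))\<^sup>2 else 0))"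
  proof (rule sum.cong[OF refl])
    fix j assume "j \<in> {..<d}"
    then show "(\<Sum>S\<in>?P. 2/d * (cmod (D (flip S j)))\<^sup>2 + (if j \<in> flip S j then 8/d * (cmod (?u (flip S j)))\<^sup>2 else 0))
      = (\<Sum>S\<in>?P. 2/d * (cmod (D S))\<^sup>2 + (if j \<in> S then 8/d * (cmod (?u S))\<^sup>2 else 0))"
      by (intro sum_flip[where f="\<lambda>S. 2/d * (cmod (D S))\<^sup>2 + (if j \<in> S then 8/d * (cmod (?u S))\<^sup>2 else 0)"]) auto
  qed
  also have "\<dots> = 2 * (\<Sum>S\<in>?P. (cmod (D S))\<^sup>2) + (\<Sum>S\<in>?P. \<Sum>j<d. (if j \<in> S then 8/d * (cmod (?u S))\<^sup>2 else 0))"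
    unfolding sum.distrib
    by (rule arg_cong2[where f="(+)", OF _ sum.swap]) (use d in \<open>simp add: sum_distrib_left\<close>)
  also have "(\<Sum>S\<in>?P. \<Sum>j<d. (if j \<in> S then 8/d * (cmod (?u S))\<^sup>2 else 0))
     \<le> (\<Sum>S\<in>?P. (real K + 1) * (8/d * (cmod (?u S))\<^sup>2))"
  proof (rule sum_mono)
    fix S assume S: "S \<in> ?P"
    have "(\<Sum>j<d. (if j \<in> S then 8/d * (cmod (?u S))\<^sup>2 else 0)) = card S * (8/d * (cmod (?u S))\<^sup>2)"
    proof -
      have "(\<Sum>j<d. (if j \<in> S then 8/d * (cmod (?u S))\<^sup>2 else 0)) = (\<Sum>j\<in>{..<d} \<inter> S. 8/d * (cmod (?u S))\<^sup>2)"
        by (rule sum.inter_restrict[symmetric]) simp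
      also have "{..<d} \<inter> S = S" using S by auto
      finally show ?thesis by simp
    qed
    also have "\<dots> \<le> (real K + 1) * (8/d * (cmod (?u S))\<^sup>2)"
    proof (cases "card S > Suc K")
      case True then show ?thesis using u[OF S True] by simp
    next
      case False then show ?thesis by (intro mult_right_mono) auto
    qed
    finally show "(\<Sum>j<d. (if j \<in> S then 8/d * (cmod (?u S))\<^sup>2 else 0)) \<le> (real K + 1) * (8/d * (cmod (?u S))\<^sup>2)" .
  qed
  also have "\<dots> = (real K + 1) * (8/d) * (\<Sum>S\<in>?P. (cmod (?u S))\<^sup>2)"
    unfolding sum_distrib_left by (simp only: mult.assoc)
  also have "\<dots> \<le> (real K + 1) * (8/d) * (2 * (?E0 + ?E1))"
    by (intro mult_left_mono overlap_bound[OF d]) auto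
  finally have "?C1 \<le> 2 * (\<Sum>S\<in>?P. (cmod (D S))\<^sup>2) + (real K + 1) * (8/d) * (2 * (?E0 + ?E1))" by simp
  moreover have "?C0 = (\<Sum>S\<in>?P. (cmod (D S))\<^sup>2)" by (simp add: C0)
  ultimately have "?C0 + ?C1 \<le> 3 * (4 * (real K + 1) / d * ?E1) + (real K + 1) * (8/d) * (2 * (?E0 + ?E1))"
    using DD by simp
  also have "\<dots> \<le> 3 * (4 * (real K + 1) / d * (?E0 + ?E1)) + (real K + 1) * (8/d) * (2 * (?E0 + ?E1))"
    using E by (intro add_right_mono mult_left_mono) auto
  also have "3 * (4 * k / d * e) + k * (8/d) * (2 * e) = 28 * k / d * e" for k e :: real
    using d by (simp add: field_simps)
  finally show ?thesis .
qed

lemma nrm2_commutator_le: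
  assumes d: "d > 1" and b: "\<And>j. cmod (\<beta> j) = 1"
    and supp: "\<And>i T. i < 2*d*d*W \<Longrightarrow> finite T \<Longrightarrow> card T > K \<Longrightarrow> h i T = 0"
  shows "nrm2 (2*d*d*W) d (commutator \<beta> d W h) \<le> 28 * (real K + 1) / d * nrm2 (2*d*d*W) d h"
proof -
  let ?n = "2*d*d" and ?P = "Pow {..<d}"
  let ?N = "\<lambda>f i. \<Sum>S\<in>?P. (cmod (f i S))\<^sup>2"
  have swap: "nrm2 (?n*W) d f = (\<Sum>w<W. \<Sum>a<?n. ?N f (a*W+w))" for f
    unfolding nrm2_def sum_mult_index[of _ ?n W] by (rule sum.swap)
  have "(\<Sum>a<?n. ?N (commutator \<beta> d W h) (a*W+w)) \<le> 28 * (real K + 1) / d * (\<Sum>a<?n. ?N h (a*W+w))"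
    if w: "w < W" for w
  proof -
    have "(\<Sum>a<?n. ?N (commutator \<beta> d W h) (a*W+w))
        = ?N (commutator \<beta> d W h) (0*W+w) + (\<Sum>j<d. ?N (commutator \<beta> d W h) ((d+j)*W+w))"
      by (rule sum_split_prep[OF d]) (use w in \<open>auto simp: commutator_def query_hat_def twist_def\<close>)
    also have "\<dots> \<le> 28 * (real K + 1) / d * (?N h (0*W+w) + (\<Sum>j<d. ?N h ((d+j)*W+w)))"
      using commutator_flag_bound[OF d w b supp] by simp
    also have "\<dots> \<le> 28 * (real K + 1) / d * (\<Sum>a<?n. ?N h (a*W+w))"
    proof (rule mult_left_mono)
      let ?G = "\<lambda>a. if a = 0 \<or> d \<le> a \<and> a < 2*d then ?N h (a*W+w) else 0"
      have "?N h (0*W+w) + (\<Sum>j<d. ?N h ((d+j)*W+w)) = ?G 0 + (\<Sum>j<d. ?G (d+j))" by simp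
      also have "\<dots> = (\<Sum>a<?n. ?G a)" by (rule sum_split_prep[OF d, symmetric]) auto
      also have "\<dots> \<le> (\<Sum>a<?n. ?N h (a*W+w))" by (rule sum_mono) (auto intro: sum_nonneg)
      finally show "?N h (0*W+w) + (\<Sum>j<d. ?N h ((d+j)*W+w)) \<le> (\<Sum>a<?n. ?N h (a*W+w))" .
    qed simp
    finally show ?thesis .
  qed
  then show ?thesis unfolding swap sum_distrib_left[of _ _ "{..<W}"]
    by (intro sum_mono) auto
qed

section \<open>The query lower bound\<close>

lemma query_hat_diff:
  "query_hat \<beta> d W (\<lambda>i S. f i S - g i S) i S = query_hat \<beta> d W f i S - query_hat \<beta> d W g i S"
proof -
  have *: "overlap \<beta> d W (\<lambda>i S. f i S - g i S) w T = overlap \<beta> d W f w T - overlap \<beta> d W g w T" for w T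
    by (simp add: overlap_def algebra_simps sum_subtractf)
  show ?thesis unfolding query_hat_def * by (simp add: algebra_simps diff_divide_distrib)
qed

text \<open>An input-independent unitary acts on the index and leaves the label alone; therefore it
  commutes with the twist and contributes no error.\<close>

definition mat_app :: "nat \<Rightarrow> complex mat \<Rightarrow> (nat \<Rightarrow> nat set \<Rightarrow> complex) \<Rightarrow> nat \<Rightarrow> nat set \<Rightarrow> complex" where
  "mat_app N V h i S = (\<Sum>j<N. V $$ (i,j) * h j S)"

lemma nrm2_mat_app:
  assumes "is_unitary N V"
  shows "nrm2 N d (mat_app N V h) = nrm2 N d h"
proof -
  have "nrm2 N d (mat_app N V h) = (\<Sum>S\<in>Pow {..<d}. \<Sum>i<N. (cmod (\<Sum>j<N. V $$ (i,j) * h j S))\<^sup>2)"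
    unfolding nrm2_def mat_app_def by (rule sum.swap)
  also have "\<dots> = (\<Sum>S\<in>Pow {..<d}. \<Sum>j<N. (cmod (h j S))\<^sup>2)"
    unfolding unitary_sum_norm[OF assms] ..
  also have "\<dots> = nrm2 N d h" unfolding nrm2_def by (rule sum.swap)
  finally show ?thesis .
qed

text \<open>Recasts the norm as an \<open>L2_set\<close>, for which the triangle inequality is
  available.\<close>

lemma sqrt_nrm2: "sqrt (nrm2 N d h) = L2_set (\<lambda>(i,S). cmod (h i S)) ({..<N} \<times> Pow {..<d})"
  by (simp add: L2_set_def nrm2_def sum.cartesian_product case_prod_beta)

lemma L2_set_cmod_triangle:
  "L2_set (\<lambda>x. cmod (f x + g x)) A \<le> L2_set (\<lambda>x. cmod (f x)) A + L2_set (\<lambda>x. cmod (g x)) A"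
proof -
  have "L2_set (\<lambda>x. cmod (f x + g x)) A \<le> L2_set (\<lambda>x. cmod (f x) + cmod (g x)) A"
    by (rule L2_set_mono) (auto intro: norm_triangle_ineq)
  also have "\<dots> \<le> L2_set (\<lambda>x. cmod (f x)) A + L2_set (\<lambda>x. cmod (g x)) A"
    by (rule L2_set_triangle_ineq)
  finally show ?thesis .
qed

lemma sqrt_nrm2_triangle:
  "sqrt (nrm2 N d (\<lambda>i S. f i S + g i S)) \<le> sqrt (nrm2 N d f) + sqrt (nrm2 N d g)"
  unfolding sqrt_nrm2 split_def by (rule L2_set_cmod_triangle)

text \<open>The state before the first query does not depend on \<open>X\<close>, so all its weight
  sits on the empty label. By \<open>adj_oracle\<close>, \<open>query_hat\<close> serves both kinds
  of query.\<close>

definition evolve_hat :: "(nat \<Rightarrow> complex) \<Rightarrow> nat \<Rightarrow> nat \<Rightarrow> complex mat \<Rightarrow> (query \<times> complex mat) list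
    \<Rightarrow> nat \<Rightarrow> nat set \<Rightarrow> complex" where
  "evolve_hat \<beta> d W V0 steps =
     foldl (\<lambda>h (q,V). mat_app (2*d*d*W) V (query_hat \<beta> d W h))
       (\<lambda>i S. if S = {} then (V0 *\<^sub>v unit_vec (2*d*d*W) 0) $ i else 0) steps"

lemma evolve_hat_Nil:
  "evolve_hat \<beta> d W V0 [] = (\<lambda>i S. if S = {} then (V0 *\<^sub>v unit_vec (2*d*d*W) 0) $ i else 0)"
  by (simp add: evolve_hat_def)

lemma evolve_hat_snoc:
  "evolve_hat \<beta> d W V0 (steps @ [(q,V)]) = mat_app (2*d*d*W) V (query_hat \<beta> d W (evolve_hat \<beta> d W V0 steps))"
  by (simp add: evolve_hat_def)

lemma final_state_snoc:
  "final_state d W V0 (steps @ [(q,V)]) U = V *\<^sub>v (query_op q U W *\<^sub>v final_state d W V0 steps U)"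
  by (simp add: final_state_def)

text \<open>The carrier claim is part of the induction because the entry formulas for matrix-vector
  products require it at every step.\<close>

lemma final_state_synth:
  assumes d: "d > 1" and "is_alg d W V0 steps" "fst ` set steps \<subseteq> {QU, QUdag}"
  shows "final_state d W V0 steps (phase_oracle \<beta> d X) \<in> carrier_vec (2*d*d*W) \<and>
    (\<forall>i<2*d*d*W. final_state d W V0 steps (phase_oracle \<beta> d X) $ i = synth d (evolve_hat \<beta> d W V0 steps i) X)"
  using assms(2,3)
proof (induction steps rule: rev_induct)
  case Nil
  then have "V0 \<in> carrier_mat (2*d*d*W) (2*d*d*W)" by (simp add: is_alg_def is_unitary_def)
  moreover have "synth d (\<lambda>S. if S = {} then c else 0) X = c" for c
  proof -
    have "synth d (\<lambda>S. if S = {} then c else 0) X = (\<Sum>S\<in>Pow {..<d}. if S = {} then c else 0)"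
      unfolding synth_def by (intro sum.cong refl) (auto simp: chi_def)
    then show ?thesis by simp
  qed
  ultimately show ?case by (auto simp: final_state_def evolve_hat_Nil)
next
  case (snoc s steps)
  obtain q V where s: "s = (q,V)" by (cases s)
  let ?N = "2*d*d*W" and ?U = "phase_oracle \<beta> d X"
  let ?v = "final_state d W V0 steps ?U"
  have IH: "?v \<in> carrier_vec ?N" "\<And>i. i < ?N \<Longrightarrow> ?v $ i = synth d (evolve_hat \<beta> d W V0 steps i) X"
    using snoc by (auto simp: is_alg_def)
  have V: "V \<in> carrier_mat ?N ?N" using snoc.prems(1) by (auto simp: is_alg_def is_unitary_def s)
  have q: "q \<in> {QU,QUdag}" using snoc.prems(2) by (auto simp: s)
  have Qv: "query_op q ?U W *\<^sub>v ?v \<in> carrier_vec ?N"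
    by (rule mult_mat_vec_carrier[OF query_op_carrier[OF oracle_carrier] IH(1)])
  have "(V *\<^sub>v (query_op q ?U W *\<^sub>v ?v)) $ i = synth d (evolve_hat \<beta> d W V0 (steps @ [s]) i) X"
    if i: "i < ?N" for i
  proof -
    have "(V *\<^sub>v (query_op q ?U W *\<^sub>v ?v)) $ i = (\<Sum>k<?N. V $$ (i,k) * (query_op q ?U W *\<^sub>v ?v) $ k)"
      by (rule mult_vec_entry[OF V Qv i])
    also have "\<dots> = (\<Sum>k<?N. V $$ (i,k) * synth d (query_hat \<beta> d W (evolve_hat \<beta> d W V0 steps) k) X)"
      by (intro sum.cong refl arg_cong2[where f="(*)"] query_op_synth[OF d q _ IH]) auto
    also have "\<dots> = synth d (evolve_hat \<beta> d W V0 (steps @ [s]) i) X"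
      unfolding s evolve_hat_snoc mat_app_def synth_sum synth_cmult ..
    finally show ?thesis .
  qed
  then show ?case using V Qv by (simp add: s final_state_snoc)
qed

lemma nrm2_evolve_hat:
  assumes d: "d > 1" and b: "\<And>j. cmod (\<beta> j) = 1" and "is_alg d W V0 steps"
  shows "nrm2 (2*d*d*W) d (evolve_hat \<beta> d W V0 steps) = 1"
  using assms(3)
proof (induction steps rule: rev_induct)
  case Nil
  let ?N = "2*d*d*W"
  have N: "?N > 0" using Nil d by (simp add: is_alg_def)
  have V0: "is_unitary ?N V0" using Nil by (simp add: is_alg_def)
  then have c: "V0 \<in> carrier_mat ?N ?N" by (simp add: is_unitary_def)
  have "nrm2 ?N d (evolve_hat \<beta> d W V0 []) = (\<Sum>i<?N. \<Sum>S\<in>Pow {..<d}. if S = {} then (cmod ((V0 *\<^sub>v unit_vec ?N 0) $ i))\<^sup>2 else 0)"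
    unfolding nrm2_def evolve_hat_Nil by (intro sum.cong refl) auto
  also have "\<dots> = (\<Sum>i<?N. (cmod ((V0 *\<^sub>v unit_vec ?N 0) $ i))\<^sup>2)" by simp
  also have "\<dots> = (\<Sum>i<?N. (cmod (\<Sum>j<?N. V0 $$ (i,j) * unit_vec ?N 0 $ j))\<^sup>2)"
    by (intro sum.cong refl) (subst mult_vec_entry[OF c], auto)
  also have "\<dots> = (\<Sum>j<?N. (cmod (unit_vec ?N 0 $ j))\<^sup>2)" by (rule unitary_sum_norm[OF V0])
  also have "\<dots> = (\<Sum>j<?N. if j = 0 then 1 else 0)" by (intro sum.cong refl) (auto simp: unit_vec_def)
  finally show ?case using N by simp
next
  case (snoc s steps)
  then show ?case by (cases s) (simp add: evolve_hat_snoc is_alg_def nrm2_mat_app nrm2_query_hat[OF d b])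
qed

lemma evolve_hat_support:
  assumes d: "d > 1" and "finite S" "card S > 2 * length steps" "i < 2*d*d*W"
  shows "evolve_hat \<beta> d W V0 steps i S = 0"
  using assms(2,3,4)
proof (induction steps arbitrary: S i rule: rev_induct)
  case Nil
  then show ?case by (auto simp: evolve_hat_Nil)
next
  case (snoc s steps)
  obtain q V where s: "s = (q,V)" by (cases s)
  have "query_hat \<beta> d W (evolve_hat \<beta> d W V0 steps) j S = 0" if "j < 2*d*d*W" for j
    by (rule query_hat_support[OF snoc.prems(1) _ that d]) (use snoc in auto)
  then show ?case by (simp add: s evolve_hat_snoc mat_app_def)
qed

text \<open>A hybrid argument: the new error is the old error sent through a norm-preserving query,
  plus the commutator on the run for the constant 1, which has norm 1. Fixing \<open>t\<close> above
  the current length keeps the error per step uniform throughout the induction.\<close>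

lemma evolve_hat_close:
  assumes d: "d > 1" and b: "\<And>j. cmod (\<beta> j) = 1" and "is_alg d W V0 steps" "length steps \<le> t"
  shows "sqrt (nrm2 (2*d*d*W) d (\<lambda>i S. evolve_hat \<beta> d W V0 steps i S
            - twist \<beta> (evolve_hat (\<lambda>_. 1) d W V0 steps) i S))
       \<le> length steps * sqrt (56 * real t / real d)"
  using assms(3,4)
proof (induction steps rule: rev_induct)
  case Nil
  have "(\<lambda>i S. evolve_hat \<beta> d W V0 [] i S - twist \<beta> (evolve_hat (\<lambda>_. 1) d W V0 []) i S) = (\<lambda>i S. 0)"
    by (intro ext) (simp add: evolve_hat_Nil twist_def phase_def)
  then show ?case by (simp add: nrm2_def)
next
  case (snoc s steps)
  obtain q V where s: "s = (q,V)" by (cases s)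
  let ?N = "2*d*d*W"
  let ?a = "evolve_hat \<beta> d W V0 steps" and ?b = "evolve_hat (\<lambda>_. 1) d W V0 steps"
  have V: "is_unitary ?N V" and alg: "is_alg d W V0 steps"
    using snoc.prems(1) by (auto simp: is_alg_def s)
  let ?e = "\<lambda>i S. ?a i S - twist \<beta> ?b i S"
  let ?e' = "\<lambda>i S. query_hat \<beta> d W ?e i S + commutator \<beta> d W ?b i S"
  have e': "?e' = (\<lambda>i S. query_hat \<beta> d W ?a i S - phase \<beta> S * query_hat (\<lambda>_. 1) d W ?b i S)"
    by (intro ext) (simp add: query_hat_diff commutator_def twist_def[of _ "query_hat (\<lambda>_. 1) d W ?b"])
  have "(\<lambda>i S. evolve_hat \<beta> d W V0 (steps @ [s]) i S - twist \<beta> (evolve_hat (\<lambda>_. 1) d W V0 (steps @ [s])) i S)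
      = mat_app ?N V ?e'"
    unfolding e' by (intro ext) (simp add: s evolve_hat_snoc mat_app_def twist_def
        sum_distrib_left sum_subtractf[symmetric] algebra_simps)
  then have "sqrt (nrm2 ?N d (\<lambda>i S. evolve_hat \<beta> d W V0 (steps @ [s]) i S - twist \<beta> (evolve_hat (\<lambda>_. 1) d W V0 (steps @ [s])) i S))
      = sqrt (nrm2 ?N d ?e')" using nrm2_mat_app[OF V] by simp
  also have "\<dots> \<le> sqrt (nrm2 ?N d (query_hat \<beta> d W ?e)) + sqrt (nrm2 ?N d (commutator \<beta> d W ?b))"
    by (rule sqrt_nrm2_triangle)
  also have "\<dots> \<le> length steps * sqrt (56 * real t / real d) + sqrt (56 * real t / real d)"
  proof (rule add_mono)
    show "sqrt (nrm2 ?N d (query_hat \<beta> d W ?e)) \<le> length steps * sqrt (56 * real t / real d)"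
      using snoc.IH[OF alg] snoc.prems(2) by (simp add: nrm2_query_hat[OF d b])
    \<comment> \<open>After \<open>length steps\<close> queries the labels have size at most
      \<open>2 * length steps\<close>. Since one more step is still to come within \<open>t\<close>,
      the resulting constant stays below \<open>56 * t / d\<close>.\<close>
    have "nrm2 ?N d (commutator \<beta> d W ?b) \<le> 28 * (real (2 * length steps) + 1) / d * nrm2 ?N d ?b"
      by (rule nrm2_commutator_le[OF d b evolve_hat_support[OF d]])
    also have "\<dots> = 28 * (real (2 * length steps) + 1) / d"
      using nrm2_evolve_hat[OF d _ alg, of "\<lambda>_. 1"] by simp
    also have "\<dots> \<le> 56 * real t / real d"
      using snoc.prems(2) by (intro divide_right_mono) auto
    finally show "sqrt (nrm2 ?N d (commutator \<beta> d W ?b)) \<le> sqrt (56 * real t / real d)" by simp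
  qed
  also have "\<dots> = length (steps @ [s]) * sqrt (56 * real t / real d)" by (simp add: algebra_simps)
  finally show ?case .
qed

text \<open>Parseval converts the average acceptance probability into a norm of the coefficients on
  accepting indices, and that norm does not see a twist by unimodular phases.\<close>

lemma sum_accept_prob:
  assumes d: "d > 1" and "is_alg d W V0 steps" "fst ` set steps \<subseteq> {QU, QUdag}"
  shows "(\<Sum>X\<in>Pow {..<d}. accept_prob (2*d*d*W) Acc (final_state d W V0 steps (phase_oracle \<beta> d X)))
    = 2^d * (L2_set (\<lambda>(i,S). cmod (evolve_hat \<beta> d W V0 steps i S))
              ({i. i < 2*d*d*W \<and> i \<in> Acc} \<times> Pow {..<d}))\<^sup>2"
proof -
  let ?A = "{i. i < 2*d*d*W \<and> i \<in> Acc}" and ?h = "evolve_hat \<beta> d W V0 steps"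
  have "(\<Sum>X\<in>Pow {..<d}. accept_prob (2*d*d*W) Acc (final_state d W V0 steps (phase_oracle \<beta> d X)))
     = (\<Sum>X\<in>Pow {..<d}. \<Sum>i\<in>?A. (cmod (synth d (?h i) X))\<^sup>2)"
    unfolding accept_prob_def
    by (intro sum.cong refl) (use final_state_synth[OF assms, of \<beta>] in auto)
  also have "\<dots> = (\<Sum>i\<in>?A. 2^d * (\<Sum>S\<in>Pow {..<d}. (cmod (?h i S))\<^sup>2))"
    by (subst sum.swap) (simp add: parseval del: Pow_iff)
  also have "\<dots> = 2^d * (\<Sum>(i,S)\<in>?A \<times> Pow {..<d}. (cmod (?h i S))\<^sup>2)"
    by (simp add: sum_distrib_left sum.cartesian_product split_def)
  also have "(\<Sum>(i,S)\<in>?A \<times> Pow {..<d}. (cmod (?h i S))\<^sup>2)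
      = (L2_set (\<lambda>(i,S). cmod (?h i S)) (?A \<times> Pow {..<d}))\<^sup>2"
    by (simp add: L2_set_def case_prod_beta sum_nonneg)
  finally show ?thesis .
qed

text \<open>Correctness separates the averaged acceptance probabilities of the two families by 1/3,
  while \<open>evolve_hat_close\<close> makes the corresponding norms nearly equal if there are too
  few queries.\<close>

lemma reality_query_lower_bound:
  assumes d: "d > 1000" and sol: "solves_reality d {QU, QUdag} W V0 steps Acc"
  shows "real (length steps) \<ge> 1/12 * real d powr (1/4)"
proof (rule ccontr)
  assume "\<not> ?thesis"
  then have small: "12 * real (length steps) < real d powr (1/4)" by simp
  let ?N = "2*d*d*W" and ?P = "Pow {..<d}" and ?t = "length steps"
  define A where "A = {i. i < ?N \<and> i \<in> Acc}"
  \<comment> \<open>The squares are 1 on one half and -1 on the other, so their sum is 0 or of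
    modulus 1 according to the parity of \<open>d\<close>.\<close>
  define \<beta> :: "nat \<Rightarrow> complex" where "\<beta> j = (if j < d div 2 then 1 else \<i>)" for j
  have b: "cmod (\<beta> j) = 1" for j by (simp add: \<beta>_def)
  have d1: "d > 1" using d by simp
  have alg: "is_alg d W V0 steps" "fst ` set steps \<subseteq> {QU, QUdag}"
    using sol by (auto simp: solves_reality_def)
  define L where "L \<gamma> = L2_set (\<lambda>(i,S). cmod (evolve_hat \<gamma> d W V0 steps i S)) (A \<times> ?P)" for \<gamma>
  have sumP: "(\<Sum>X\<in>?P. accept_prob ?N Acc (final_state d W V0 steps (phase_oracle \<gamma> d X))) = 2^d * (L \<gamma>)\<^sup>2" for \<gamma>
    unfolding L_def A_def by (rule sum_accept_prob[OF d1 alg])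
  have cardP: "real (card ?P) = 2^d" by (simp add: card_Pow)
  \<comment> \<open>Each sign pattern is an instance of realness 1, so the guarantee survives
    summation over \<open>X\<close>.\<close>
  have "2^d * (2/3) \<le> 2^d * (L (\<lambda>_. 1))\<^sup>2"
  proof -
    have "2/3 \<le> accept_prob ?N Acc (final_state d W V0 steps (phase_oracle (\<lambda>_. 1) d X))" for X
    proof -
      have "is_pure_state d (phase_state (\<lambda>_. 1) d X)" "state_prep d (phase_state (\<lambda>_. 1) d X) (phase_oracle (\<lambda>_. 1) d X)"
        using d1 by (auto intro!: phase_state_pure oracle_state_prep)
      moreover have "realness d (phase_state (\<lambda>_. 1) d X) = 1"
        using d by (simp add: realness_phase_state)
      ultimately show ?thesis using sol unfolding solves_reality_def by blast
    qed
    then have "(\<Sum>X\<in>?P. 2/3) \<le> 2^d * (L (\<lambda>_. 1))\<^sup>2" unfolding sumP[symmetric] by (intro sum_mono)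
    then show ?thesis using cardP by simp
  qed
  then have L1: "2/3 \<le> (L (\<lambda>_. 1))\<^sup>2" by simp
  have "2^d * (L \<beta>)\<^sup>2 \<le> 2^d * (1/3)"
  proof -
    have "accept_prob ?N Acc (final_state d W V0 steps (phase_oracle \<beta> d X)) \<le> 1/3" for X
    proof -
      have "is_pure_state d (phase_state \<beta> d X)" "state_prep d (phase_state \<beta> d X) (phase_oracle \<beta> d X)"
        using d1 b by (auto intro!: phase_state_pure oracle_state_prep)
      moreover have "realness d (phase_state \<beta> d X) < 1/10"
      proof -
        have "(\<Sum>j<d. (\<beta> j)\<^sup>2) = (\<Sum>j\<in>{..<d div 2}. 1) + (\<Sum>j\<in>{d div 2..<d}. -1)"
        proof -
          have "(\<Sum>j\<in>{..<d div 2} \<union> {d div 2..<d}. (\<beta> j)\<^sup>2)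
              = (\<Sum>j\<in>{..<d div 2}. (\<beta> j)\<^sup>2) + (\<Sum>j\<in>{d div 2..<d}. (\<beta> j)\<^sup>2)"
            by (rule sum.union_disjoint) auto
          moreover have "{..<d div 2} \<union> {d div 2..<d} = {..<d}" by auto
          ultimately show ?thesis by (simp add: \<beta>_def)
        qed
        also have "\<dots> = of_real (real (d div 2) - real (d - d div 2))" by simp
        finally have eq: "(\<Sum>j<d. (\<beta> j)\<^sup>2) = of_real (real (d div 2) - real (d - d div 2))" .
        have "cmod (\<Sum>j<d. (\<beta> j)\<^sup>2) = \<bar>real (d div 2) - real (d - d div 2)\<bar>"
          unfolding eq norm_of_real ..
        also have "\<dots> \<le> 1" by linarith
        finally have "cmod (\<Sum>j<d. (\<beta> j)\<^sup>2) / d \<le> 1 / d" by (intro divide_right_mono) auto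
        also have "1 / real d \<le> 1/1000" using d by (simp add: field_simps)
        finally have "(cmod (\<Sum>j<d. (\<beta> j)\<^sup>2) / d)\<^sup>2 \<le> (1/1000)\<^sup>2" by (intro power_mono) auto
        also have "(1/1000)\<^sup>2 < (1/10::real)" by (simp add: power2_eq_square)
        finally show ?thesis using realness_phase_state[of d \<beta> X] d by simp
      qed
      ultimately show ?thesis using sol unfolding solves_reality_def by blast
    qed
    then have "2^d * (L \<beta>)\<^sup>2 \<le> (\<Sum>X\<in>?P. 1/3)" unfolding sumP[symmetric] by (intro sum_mono)
    then show ?thesis using cardP by simp
  qed
  then have Lb: "(L \<beta>)\<^sup>2 \<le> 1/3" by simp
  let ?e = "\<lambda>i S. evolve_hat \<beta> d W V0 steps i S - twist \<beta> (evolve_hat (\<lambda>_. 1) d W V0 steps) i S"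
  define err where "err = real ?t * sqrt (56 * real ?t / real d)"
  \<comment> \<open>Twisting leaves each modulus unchanged, so the run for the constant 1 may be
    replaced by its twist, which is the run for \<open>\<beta>\<close> minus the error.\<close>
  have "L (\<lambda>_. 1) = L2_set (\<lambda>x. cmod ((case x of (i,S) \<Rightarrow> evolve_hat \<beta> d W V0 steps i S) + (case x of (i,S) \<Rightarrow> - ?e i S))) (A \<times> ?P)"
    unfolding L_def by (intro L2_set_cong refl) (auto simp: twist_def norm_mult cmod_phase b)
  also have "\<dots> \<le> L2_set (\<lambda>x. cmod (case x of (i,S) \<Rightarrow> evolve_hat \<beta> d W V0 steps i S)) (A \<times> ?P)
      + L2_set (\<lambda>x. cmod (case x of (i,S) \<Rightarrow> - ?e i S)) (A \<times> ?P)"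
    by (rule L2_set_cmod_triangle)
  also have "\<dots> = L \<beta> + L2_set (\<lambda>(i,S). cmod (?e i S)) (A \<times> ?P)"
    unfolding L_def split_def by (simp only: norm_minus_cancel)
  also have "L2_set (\<lambda>(i,S). cmod (?e i S)) (A \<times> ?P) \<le> L2_set (\<lambda>(i,S). cmod (?e i S)) ({..<?N} \<times> ?P)"
    unfolding L2_set_def by (intro real_sqrt_le_mono sum_mono2) (auto simp: A_def)
  also have "\<dots> \<le> err"
    unfolding sqrt_nrm2[symmetric] err_def by (rule evolve_hat_close[OF d1 b alg(1) order_refl])
  finally have LL: "L (\<lambda>_. 1) \<le> L \<beta> + err" by simp
  \<comment> \<open>Here 1728 is 12 cubed. The hypothesis yields the exponent 3/4, which is relaxed
    to 1; then the squared error is at most 56/1728, below 0.04.\<close>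
  have "real ?t ^ 3 * 1728 = (12 * real ?t) ^ 3" by (simp add: power_mult_distrib)
  also have "\<dots> \<le> (real d powr (1/4)) ^ 3" using small by (intro power_mono) auto
  also have "\<dots> = real d powr (3/4)" using d by (simp add: powr_power)
  also have "\<dots> \<le> real d powr 1" using d by (intro powr_mono) auto
  finally have t3: "real ?t ^ 3 * 1728 \<le> d" using d by simp
  have err2: "err\<^sup>2 \<le> 0.04"
  proof -
    have "err\<^sup>2 = (real ?t)\<^sup>2 * (56 * real ?t / d)" by (simp add: err_def power_mult_distrib)
    also have "\<dots> = 56 * real ?t ^ 3 / d" by (simp add: power2_eq_square power3_eq_cube)
    also have "\<dots> \<le> 0.04" using t3 d by (simp add: field_simps)
    finally show ?thesis .
  qed
  \<comment> \<open>The numbers fit since 0.58 squared exceeds 1/3, whereas 0.78 squared is about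
    0.608 and stays below 2/3.\<close>
  have "err \<le> 0.2" by (rule power2_le_imp_le) (use err2 in \<open>auto simp: power2_eq_square\<close>)
  moreover have "L \<beta> \<le> 0.58" by (rule power2_le_imp_le) (use Lb in \<open>auto simp: power2_eq_square\<close>)
  ultimately have "L (\<lambda>_. 1) \<le> 0.78" using LL by simp
  moreover have "0 \<le> L (\<lambda>_. 1)" by (simp add: L_def)
  ultimately have "(L (\<lambda>_. 1))\<^sup>2 \<le> 0.78\<^sup>2" by (rule power_mono)
  then show False using L1 by (simp add: power2_eq_square)
qed

section \<open>The swap test\<close>

definition vkron :: "complex vec \<Rightarrow> complex vec \<Rightarrow> complex vec" where
  "vkron x y = vec (dim_vec x * dim_vec y) (\<lambda>i. x $ (i div dim_vec y) * y $ (i mod dim_vec y))"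

lemma vkron_carrier: "x \<in> carrier_vec n \<Longrightarrow> y \<in> carrier_vec m \<Longrightarrow> vkron x y \<in> carrier_vec (n*m)"
  by (auto simp: vkron_def)

lemma vkron_index:
  assumes "x \<in> carrier_vec n" "y \<in> carrier_vec m" "a < n" "b < m"
  shows "vkron x y $ (a*m+b) = x $ a * y $ b"
  using assms pair_index_less[of a n b m] by (auto simp: vkron_def)

lemma eq_vecI_pair:
  assumes "x \<in> carrier_vec (n*m)" "y \<in> carrier_vec (n*m)"
    and "\<And>a b. a < n \<Longrightarrow> b < m \<Longrightarrow> x $ (a*m+b) = y $ (a*m+b)"
  shows "x = y"
proof (rule eq_vecI)
  fix i assume "i < dim_vec y"
  then have "i < n*m" using assms(2) by auto
  then show "x $ i = y $ i" using assms(3) by (metis index_decompose)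
qed (use assms in auto)

text \<open>Both bracketings assign the same position to a triple of indices. This allows registers
  to be regrouped without any matrix.\<close>

lemma vkron_assoc:
  assumes "x \<in> carrier_vec n" "y \<in> carrier_vec m" "z \<in> carrier_vec k"
  shows "vkron (vkron x y) z = vkron x (vkron y z)"
proof (rule eq_vecI_pair[of _ "n*m" k])
  note c = vkron_carrier[OF assms(1,2)] vkron_carrier[OF assms(2,3)]
  show "vkron (vkron x y) z \<in> carrier_vec (n*m*k)" by (rule vkron_carrier[OF c(1) assms(3)])
  show "vkron x (vkron y z) \<in> carrier_vec (n*m*k)"
    using vkron_carrier[OF assms(1) c(2)] by (simp add: mult.assoc)
  fix i e assume i: "i < n*m" and e: "e < k"
  obtain a b where ab: "a < n" "b < m" "i = a*m+b" using i by (rule index_decompose)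
  have "vkron (vkron x y) z $ (i*k+e) = x $ a * y $ b * z $ e"
    using vkron_index[OF c(1) assms(3) i e] vkron_index[OF assms(1,2) ab(1,2)] ab by simp
  moreover have "vkron x (vkron y z) $ (a*(m*k) + (b*k+e)) = x $ a * (y $ b * z $ e)"
    using vkron_index[OF assms(1) c(2) ab(1) pair_index_less[OF ab(2) e]]
      vkron_index[OF assms(2,3) ab(2) e] by simp
  moreover have "a*(m*k) + (b*k+e) = i*k+e" using ab by (simp add: algebra_simps)
  ultimately show "vkron (vkron x y) z $ (i*k+e) = vkron x (vkron y z) $ (i*k+e)" by simp
qed

lemma vkron_unit:
  assumes "n > 0" "m > 0"
  shows "vkron (unit_vec n 0) (unit_vec m 0) = unit_vec (n*m) 0"
proof (rule eq_vecI_pair)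
  fix a b assume ab: "a < n" "b < m"
  show "vkron (unit_vec n 0) (unit_vec m 0) $ (a*m+b) = unit_vec (n*m) 0 $ (a*m+b)"
    using ab assms pair_index_less[OF ab] vkron_index[OF unit_vec_carrier unit_vec_carrier ab, of 0 0]
    by (auto simp: unit_vec_def)
qed (auto intro: vkron_carrier)

lemma kron_vkron:
  assumes A: "A \<in> carrier_mat n n" and B: "B \<in> carrier_mat m m"
    and x: "x \<in> carrier_vec n" and y: "y \<in> carrier_vec m"
  shows "kron A B *\<^sub>v vkron x y = vkron (A *\<^sub>v x) (B *\<^sub>v y)"
proof (rule eq_vecI_pair)
  note c = kron_carrier[OF A B] vkron_carrier[OF x y]
  show "kron A B *\<^sub>v vkron x y \<in> carrier_vec (n*m)" using c by (rule mult_mat_vec_carrier)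
  show "vkron (A *\<^sub>v x) (B *\<^sub>v y) \<in> carrier_vec (n*m)" using assms by (intro vkron_carrier) auto
  fix a b assume ab: "a < n" "b < m"
  have "(kron A B *\<^sub>v vkron x y) $ (a*m+b) = (\<Sum>k<n*m. kron A B $$ (a*m+b,k) * vkron x y $ k)"
    by (rule mult_vec_entry[OF c pair_index_less[OF ab]])
  also have "\<dots> = (\<Sum>k<n. \<Sum>l<m. (A $$ (a,k) * x $ k) * (B $$ (b,l) * y $ l))"
    unfolding sum_mult_index using ab
    by (intro sum.cong refl) (simp add: kron_entry[OF A B] vkron_index[OF x y])
  also have "\<dots> = (A *\<^sub>v x) $ a * (B *\<^sub>v y) $ b"
    unfolding mult_vec_entry[OF A x ab(1)] mult_vec_entry[OF B y ab(2)] by (simp add: sum_product)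
  also have "\<dots> = vkron (A *\<^sub>v x) (B *\<^sub>v y) $ (a*m+b)"
    by (rule vkron_index[symmetric]) (use assms ab in auto)
  finally show "(kron A B *\<^sub>v vkron x y) $ (a*m+b) = vkron (A *\<^sub>v x) (B *\<^sub>v y) $ (a*m+b)" .
qed

section \<open>Permutation matrices and the exchange of tensor factors\<close>

definition perm_mat :: "nat \<Rightarrow> (nat \<Rightarrow> nat) \<Rightarrow> complex mat" where
  "perm_mat N \<sigma> = mat N N (\<lambda>(i,j). if j = \<sigma> i then 1 else 0)"

lemma perm_mat_unitary:
  assumes \<sigma>: "bij_betw \<sigma> {..<N} {..<N}"
  shows "is_unitary N (perm_mat N \<sigma>)"
proof -
  have rng: "\<sigma> i < N" if "i < N" for i using \<sigma> that by (auto simp: bij_betw_def)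
  have inj: "\<sigma> i = \<sigma> j \<longleftrightarrow> i = j" if "i < N" "j < N" for i j
    using \<sigma> that by (auto simp: bij_betw_def inj_on_def)
  have 1: "(\<Sum>k<N. perm_mat N \<sigma> $$ (i,k) * cnj (perm_mat N \<sigma> $$ (j,k))) = (if i = j then 1 else 0)"
    if "i < N" "j < N" for i j
  proof -
    have "(\<Sum>k<N. perm_mat N \<sigma> $$ (i,k) * cnj (perm_mat N \<sigma> $$ (j,k)))
        = (\<Sum>k<N. if k = \<sigma> i then (if i = j then 1 else 0) else 0)"
      using that inj by (intro sum.cong refl) (auto simp: perm_mat_def)
    then show ?thesis using rng that by simp
  qed
  have 2: "(\<Sum>k<N. cnj (perm_mat N \<sigma> $$ (k,i)) * perm_mat N \<sigma> $$ (k,j)) = (if i = j then 1 else 0)"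
    if ij: "i < N" "j < N" for i j
  proof -
    have "i \<in> \<sigma> ` {..<N}" using \<sigma> ij(1) by (simp add: bij_betw_def)
    then obtain l where l: "l < N" "\<sigma> l = i" by auto
    have "(\<Sum>k<N. cnj (perm_mat N \<sigma> $$ (k,i)) * perm_mat N \<sigma> $$ (k,j))
        = (\<Sum>k<N. if k = l then (if i = j then 1 else 0) else 0)"
      using ij inj l by (intro sum.cong refl) (auto simp: perm_mat_def)
    then show ?thesis using l by simp
  qed
  show ?thesis using 1 2 by (simp add: is_unitary_iff) (simp add: perm_mat_def)
qed

lemma perm_mat_mult_vec:
  assumes "v \<in> carrier_vec N" "i < N" "\<sigma> i < N"
  shows "(perm_mat N \<sigma> *\<^sub>v v) $ i = v $ \<sigma> i"
proof -
  have "(perm_mat N \<sigma> *\<^sub>v v) $ i = (\<Sum>k<N. perm_mat N \<sigma> $$ (i,k) * v $ k)"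
    by (rule mult_vec_entry[of _ N]) (use assms in \<open>auto simp: perm_mat_def\<close>)
  also have "\<dots> = (\<Sum>k<N. if k = \<sigma> i then v $ \<sigma> i else 0)"
    using assms by (intro sum.cong refl) (auto simp: perm_mat_def)
  finally show ?thesis using assms by simp
qed

text \<open>Reads a position of the product with factors in the order \<open>m\<close>,
  \<open>n\<close> and returns the position of the same pair in the order \<open>n\<close>,
  \<open>m\<close>. This is the direction required because \<open>perm_mat\<close> pulls vectors
  back.\<close>

definition exchange_index :: "nat \<Rightarrow> nat \<Rightarrow> nat \<Rightarrow> nat" where
  "exchange_index n m i = (i mod n) * m + i div n"

definition exchange_mat :: "nat \<Rightarrow> nat \<Rightarrow> complex mat" where
  "exchange_mat n m = perm_mat (n*m) (exchange_index n m)"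

lemma exchange_index_pair: "a < n \<Longrightarrow> exchange_index n m (b*n+a) = a*m+b"
  by (simp add: exchange_index_def)

lemma exchange_index_less:
  assumes "i < n*m" shows "exchange_index n m i < n*m"
proof -
  obtain b a where "b < m" "a < n" "i = b*n+a"
    using assms by (metis index_decompose mult.commute)
  then show ?thesis by (simp add: exchange_index_pair pair_index_less)
qed

lemma exchange_index_exchange:
  assumes "i < n*m" shows "exchange_index m n (exchange_index n m i) = i"
proof -
  obtain b a where "b < m" "a < n" "i = b*n+a"
    using assms by (metis index_decompose mult.commute)
  then show ?thesis by (simp add: exchange_index_pair)
qed

lemma exchange_mat_unitary: "is_unitary (n*m) (exchange_mat n m)"
  unfolding exchange_mat_def
proof (rule perm_mat_unitary, rule bij_betw_byWitness[where f'="exchange_index m n"])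
  show "\<forall>a\<in>{..<n*m}. exchange_index m n (exchange_index n m a) = a"
    by (simp add: exchange_index_exchange)
  show "\<forall>a\<in>{..<n*m}. exchange_index n m (exchange_index m n a) = a"
    by (simp add: exchange_index_exchange mult.commute)
  show "exchange_index n m ` {..<n*m} \<subseteq> {..<n*m}"
    by (auto simp: exchange_index_less)
  show "exchange_index m n ` {..<n*m} \<subseteq> {..<n*m}"
    using exchange_index_less[of _ m n] by (auto simp: mult.commute)
qed

lemma exchange_mat_vkron:
  assumes x: "x \<in> carrier_vec n" and y: "y \<in> carrier_vec m"
  shows "exchange_mat n m *\<^sub>v vkron x y = vkron y x"
proof (rule eq_vecI_pair[of _ m n])
  show "exchange_mat n m *\<^sub>v vkron x y \<in> carrier_vec (m*n)"
    by (simp add: exchange_mat_def perm_mat_def mult.commute carrier_vecI)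
  show "vkron y x \<in> carrier_vec (m*n)" using y x by (rule vkron_carrier)
  fix b a assume ba: "b < m" "a < n"
  have "(exchange_mat n m *\<^sub>v vkron x y) $ (b*n+a) = vkron x y $ exchange_index n m (b*n+a)"
    unfolding exchange_mat_def using ba pair_index_less[OF ba]
    by (intro perm_mat_mult_vec vkron_carrier x y exchange_index_less) (auto simp: mult.commute)
  then show "(exchange_mat n m *\<^sub>v vkron x y) $ (b*n+a) = vkron y x $ (b*n+a)"
    using ba by (simp add: exchange_index_pair vkron_index[OF x y] vkron_index[OF y x])
qed

text \<open>The change of basis that diagonalises the involution \<open>\<tau>\<close>: for a two-element orbit the smaller
  index carries the symmetric and the larger one the antisymmetric combination.\<close>

definition sym_mat :: "nat \<Rightarrow> (nat \<Rightarrow> nat) \<Rightarrow> complex mat" where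
  "sym_mat N \<tau> = mat N N (\<lambda>(i,j). if \<tau> i = i then (if j = i then 1 else 0)
     else if j = i then (if i < \<tau> i then 1 else -1) / sqrt 2
     else if j = \<tau> i then 1 / sqrt 2 else 0)"

locale involution =
  fixes N :: nat and \<tau> :: "nat \<Rightarrow> nat"
  assumes range: "i < N \<Longrightarrow> \<tau> i < N" and invol: "i < N \<Longrightarrow> \<tau> (\<tau> i) = i"
begin

lemma sym_mat_row:
  assumes "i < N"
  shows "(\<Sum>k<N. sym_mat N \<tau> $$ (i,k) * f k) =
    (if \<tau> i = i then f i else ((if i < \<tau> i then f i else - f i) + f (\<tau> i)) / sqrt 2)"
proof (cases "\<tau> i = i")
  case True
  have "(\<Sum>k<N. sym_mat N \<tau> $$ (i,k) * f k) = (\<Sum>k<N. if k = i then f i else 0)"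
    using assms True by (intro sum.cong refl) (auto simp: sym_mat_def)
  then show ?thesis using assms True by simp
next
  case False
  have "(\<Sum>k<N. sym_mat N \<tau> $$ (i,k) * f k) =
    (\<Sum>k<N. (if k = i then (if i < \<tau> i then f i else - f i) / sqrt 2 else 0) + (if k = \<tau> i then f (\<tau> i) / sqrt 2 else 0))"
    using assms False by (intro sum.cong refl) (auto simp: sym_mat_def)
  also have "\<dots> = (if i < \<tau> i then f i else - f i) / sqrt 2 + f (\<tau> i) / sqrt 2"
    unfolding sum.distrib using assms range[OF assms] by simp
  finally show ?thesis using False by (simp add: add_divide_distrib)
qed

text \<open>Up to ordering of the basis the matrix consists of 1s on fixed points and Hadamard
  blocks on two-element orbits. It is real and symmetric, so the column relations reduce to the row
  relations.\<close>

lemma sym_mat_unitary: "is_unitary N (sym_mat N \<tau>)"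
proof -
  have inj: "\<tau> i = j \<longleftrightarrow> i = \<tau> j" if "i < N" "j < N" for i j
    using invol that by metis
  have sq: "2 / complex_of_real (sqrt 2) = complex_of_real (sqrt 2)"
    by (simp add: divide_eq_eq flip: of_real_mult)
  have sym: "cnj (sym_mat N \<tau> $$ (j,i)) = sym_mat N \<tau> $$ (i,j)" if "i < N" "j < N" for i j
    using that inj[of i j] inj[of j i] by (auto simp: sym_mat_def)
  have 1: "(\<Sum>k<N. sym_mat N \<tau> $$ (i,k) * cnj (sym_mat N \<tau> $$ (j,k))) = (if i = j then 1 else 0)"
    if ij: "i < N" "j < N" for i j
  proof -
    have t: "\<tau> i < N" "\<tau> (\<tau> i) = i" using range invol ij by auto
    have e: "sym_mat N \<tau> $$ (j,k) = (if \<tau> j = j then (if k = j then 1 else 0)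
       else if k = j then (if j < \<tau> j then 1 else -1) / sqrt 2
       else if k = \<tau> j then 1 / sqrt 2 else 0)" if "k < N" for k
      using that ij by (simp add: sym_mat_def)
    consider "\<tau> i = i" | "\<tau> i \<noteq> i" "j = i" | "\<tau> i \<noteq> i" "j = \<tau> i" | "\<tau> i \<noteq> i" "j \<noteq> i" "j \<noteq> \<tau> i"
      by blast
    then show ?thesis
    proof cases
      case 1
      then have "i \<noteq> \<tau> j" if "i \<noteq> j" using that inj[OF ij] by metis
      then show ?thesis
        unfolding sym_mat_row[OF ij(1)] e[OF ij(1)] using 1 by (cases "i = j") auto
    next
      case 2
      then show ?thesis
        unfolding sym_mat_row[OF ij(1)] e[OF ij(1)] e[OF t(1)]
        by (simp add: sq)
    next
      case 3
      then show ?thesis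
        unfolding sym_mat_row[OF ij(1)] e[OF ij(1)] e[OF t(1)] using t(2) by simp
    next
      case 4
      then have "\<tau> i \<noteq> \<tau> j" "i \<noteq> \<tau> j" using inj[OF ij] invol[OF ij(2)] t(2) by metis+
      then show ?thesis
        unfolding sym_mat_row[OF ij(1)] e[OF ij(1)] e[OF t(1)] using 4 by simp
    qed
  qed
  have 2: "(\<Sum>k<N. cnj (sym_mat N \<tau> $$ (k,i)) * sym_mat N \<tau> $$ (k,j)) = (if i = j then 1 else 0)"
    if ij: "i < N" "j < N" for i j
  proof -
    have "(\<Sum>k<N. cnj (sym_mat N \<tau> $$ (k,i)) * sym_mat N \<tau> $$ (k,j))
        = (\<Sum>k<N. sym_mat N \<tau> $$ (i,k) * cnj (sym_mat N \<tau> $$ (j,k)))"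
      using ij sym by (intro sum.cong refl arg_cong2[where f="(*)"]) auto
    then show ?thesis using 1 ij by simp
  qed
  show ?thesis using 1 2 by (simp add: is_unitary_iff) (simp add: sym_mat_def)
qed

lemma sum_reindex: "(\<Sum>i<N. f (\<tau> i)) = (\<Sum>i<N. f i)"
  by (rule sum.reindex_bij_witness[where i=\<tau> and j=\<tau>]) (auto simp: range invol)

text \<open>The indices with \<open>i \<le> \<tau> i\<close> carry the symmetric part, so the left
  side is the squared norm of the projection of \<open>p\<close> onto the invariant vectors of
  \<open>\<tau>\<close>, and the right side is the usual swap-test formula.\<close>

lemma sym_mat_accept:
  assumes p: "p \<in> carrier_vec N"
  shows "(\<Sum>i<N. if i \<le> \<tau> i then (cmod ((sym_mat N \<tau> *\<^sub>v p) $ i))\<^sup>2 else 0)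
    = ((\<Sum>i<N. (cmod (p $ i))\<^sup>2) + Re (\<Sum>i<N. p $ i * cnj (p $ \<tau> i))) / 2"
proof -
  have row: "(sym_mat N \<tau> *\<^sub>v p) $ i =
    (if \<tau> i = i then p $ i else ((if i < \<tau> i then p $ i else - p $ i) + p $ \<tau> i) / sqrt 2)" if "i < N" for i
  proof -
    have "(sym_mat N \<tau> *\<^sub>v p) $ i = (\<Sum>k<N. sym_mat N \<tau> $$ (i,k) * p $ k)"
      by (rule mult_vec_entry[of _ N]) (use p that in \<open>auto simp: sym_mat_def\<close>)
    then show ?thesis using sym_mat_row[OF that] by simp
  qed
  \<comment> \<open>\<open>G\<close> spreads the weight of the symmetric part evenly over an orbit,
    while \<open>F\<close> puts it all on the smaller index; the orbit sums agree, which is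
    \<open>FF\<close>.\<close>
  define G where "G i = (cmod (p $ i + p $ \<tau> i))\<^sup>2 / 4" for i
  define F where "F i = (if i \<le> \<tau> i then (cmod ((sym_mat N \<tau> *\<^sub>v p) $ i))\<^sup>2 else 0)" for i
  have FF: "F i + F (\<tau> i) = 2 * G i" if i: "i < N" for i
  proof -
    consider "\<tau> i = i" | "i < \<tau> i" | "\<tau> i < i" by linarith
    then show ?thesis
    proof cases
      case 1
      have "p $ i + p $ i = 2 * p $ i" by simp
      then show ?thesis using 1 i
        by (simp add: F_def G_def row norm_mult power_mult_distrib)
    next
      case 2
      then show ?thesis using i invol[OF i]
        by (simp add: F_def G_def row norm_divide power_divide)
    next
      case 3
      then show ?thesis using i invol[OF i] range[OF i]
        by (simp add: F_def G_def row norm_divide power_divide add.commute)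
    qed
  qed
  have "2 * (\<Sum>i<N. F i) = (\<Sum>i<N. F i) + (\<Sum>i<N. F (\<tau> i))" by (simp add: sum_reindex)
  also have "\<dots> = (\<Sum>i<N. 2 * G i)" unfolding sum.distrib[symmetric] by (intro sum.cong refl FF) auto
  finally have "(\<Sum>i<N. F i) = (\<Sum>i<N. G i)" by (simp add: sum_distrib_left[symmetric])
  also have "\<dots> = (\<Sum>i<N. ((cmod (p $ i))\<^sup>2 + (cmod (p $ \<tau> i))\<^sup>2 + 2 * Re (p $ i * cnj (p $ \<tau> i))) / 4)"
    unfolding G_def cmod_power2 by (intro sum.cong refl) (simp add: power2_eq_square algebra_simps)
  also have "\<dots> = ((\<Sum>i<N. (cmod (p $ i))\<^sup>2) + (\<Sum>i<N. (cmod (p $ \<tau> i))\<^sup>2) + 2 * (\<Sum>i<N. Re (p $ i * cnj (p $ \<tau> i)))) / 4"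
    by (simp only: sum_divide_distrib[symmetric] sum.distrib sum_distrib_left[symmetric])
  also have "(\<Sum>i<N. (cmod (p $ \<tau> i))\<^sup>2) = (\<Sum>i<N. (cmod (p $ i))\<^sup>2)"
    by (rule sum_reindex[where f="\<lambda>i. (cmod (p $ i))\<^sup>2"])
  finally show ?thesis by (simp add: F_def)
qed

end

section \<open>The swap test on the B registers\<close>

definition swap_B :: "nat \<Rightarrow> nat \<Rightarrow> nat" where
  "swap_B d i = (let n = 2*d*d; a = i div n; b = i mod n in
     ((a div d)*d + b mod d)*n + ((b div d)*d + a mod d))"

text \<open>Only the B components \<open>j\<close> and \<open>j'\<close> trade places. The A
  components stay, so the test compares reduced states and not their purifications.\<close>

lemma swap_B_index:
  assumes "k < 2*d" "j < d" "k' < 2*d" "j' < d"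
  shows "swap_B d ((k*d+j)*(2*d*d) + (k'*d+j')) = (k*d+j')*(2*d*d) + (k'*d+j)"
proof -
  have "k'*d+j' < 2*d*d" using assms by (intro pair_index_less) auto
  note outer = pair_index_div_mod[OF this]
  show ?thesis
    unfolding swap_B_def Let_def outer pair_index_div_mod[OF assms(2)] pair_index_div_mod[OF assms(4)] ..
qed

lemma swap_B_decompose:
  fixes i d :: nat
  assumes "i < (2*d*d)*(2*d*d)"
  obtains k j k' j' where "k < 2*d" "j < d" "k' < 2*d" "j' < d" "i = (k*d+j)*(2*d*d) + (k'*d+j')"
proof -
  obtain a b where ab: "a < 2*d*d" "b < 2*d*d" "i = a*(2*d*d)+b" using assms by (rule index_decompose)
  obtain k j where "k < 2*d" "j < d" "a = k*d+j" using ab(1) by (rule index_decompose)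
  moreover obtain k' j' where "k' < 2*d" "j' < d" "b = k'*d+j'" using ab(2) by (rule index_decompose)
  ultimately show ?thesis using ab(3) by (intro that) auto
qed

lemma swap_B_involution: "involution ((2*d*d)*(2*d*d)) (swap_B d)"
proof
  fix i assume "i < (2*d*d)*(2*d*d)"
  then obtain k j k' j' where *: "k < 2*d" "j < d" "k' < 2*d" "j' < d" "i = (k*d+j)*(2*d*d) + (k'*d+j')"
    by (rule swap_B_decompose)
  show "swap_B d i < (2*d*d)*(2*d*d)"
    unfolding *(5) swap_B_index[OF *(1-4)] using * by (intro pair_index_less) auto
  show "swap_B d (swap_B d i) = i"
    unfolding *(5) swap_B_index[OF *(1-4)] using * by (intro swap_B_index) auto
qed

text \<open>Whatever the preparation unitary leaves in register A, these Gram sums over A are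
  determined by the state alone.\<close>

lemma state_prep_density:
  assumes prep: "state_prep d \<psi> U" and pure: "is_pure_state d \<psi>" and ij: "i < d" "j < d"
  defines "u \<equiv> U *\<^sub>v unit_vec (2*d*d) 0"
  shows "(\<Sum>k<2*d. u $ (k*d+i) * cnj (u $ (k*d+j))) = \<psi> $ i * cnj (\<psi> $ j)"
proof -
  have "dim_vec u = 2*d*d" using prep by (auto simp: u_def state_prep_def is_unitary_def)
  then have "(\<Sum>k<2*d. u $ (k*d+i) * cnj (u $ (k*d+j))) = ptrace_A (2*d) d (outer u) $$ (i,j)"
    using ij pair_index_less[of _ "2*d" _ d] by (simp add: ptrace_A_def outer_def)
  also have "\<dots> = outer \<psi> $$ (i,j)" using prep by (simp add: state_prep_def u_def)
  also have "\<dots> = \<psi> $ i * cnj (\<psi> $ j)" using ij pure by (auto simp: is_pure_state_def outer_def)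
  finally show ?thesis .
qed

lemma conj_mat_mult_unit:
  assumes "U \<in> carrier_mat n n" "i < n"
  shows "(conj_mat U *\<^sub>v unit_vec n 0) $ i = cnj ((U *\<^sub>v unit_vec n 0) $ i)"
proof -
  have c: "conj_mat U \<in> carrier_mat n n" using assms by (simp add: conj_mat_def)
  show ?thesis
    unfolding mult_vec_entry[OF assms(1) unit_vec_carrier assms(2)] mult_vec_entry[OF c unit_vec_carrier assms(2)] cnj_sum
    using assms by (intro sum.cong refl) (auto simp: conj_mat_def unit_vec_def)
qed

text \<open>The expectation of the swap is the trace of the product of the reduced state and its
  entrywise conjugate, which for a pure state is the realness.\<close>

lemma swap_test_accept:
  assumes prep: "state_prep d \<psi> U" and pure: "is_pure_state d \<psi>"
  defines "u \<equiv> U *\<^sub>v unit_vec (2*d*d) 0" and "u' \<equiv> conj_mat U *\<^sub>v unit_vec (2*d*d) 0"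
    and "M \<equiv> (2*d*d)*(2*d*d)"
  shows "(\<Sum>i<M. if i \<le> swap_B d i then (cmod ((sym_mat M (swap_B d) *\<^sub>v vkron u' u) $ i))\<^sup>2 else 0)
    = (1 + realness d \<psi>) / 2"
proof -
  let ?n = "2*d*d"
  interpret involution M "swap_B d" unfolding M_def by (rule swap_B_involution)
  have U: "U \<in> carrier_mat ?n ?n" using prep by (simp add: state_prep_def is_unitary_def)
  have u: "u \<in> carrier_vec ?n" and u': "u' \<in> carrier_vec ?n"
    using U by (auto simp: u_def u'_def conj_mat_def)
  have p: "vkron u' u \<in> carrier_vec M" unfolding M_def by (rule vkron_carrier[OF u' u])
  have idx: "vkron u' u $ (a*?n+b) = cnj (u $ a) * u $ b" if "a < ?n" "b < ?n" for a b
    using vkron_index[OF u' u that] conj_mat_mult_unit[OF U that(1)] by (simp add: u_def u'_def)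
  note dens = state_prep_density[OF prep pure, folded u_def]
  have nu: "(\<Sum>a<?n. (cmod (u $ a))\<^sup>2) = 1"
  proof -
    have "complex_of_real (\<Sum>a<?n. (cmod (u $ a))\<^sup>2) = (\<Sum>a<?n. u $ a * cnj (u $ a))"
      by (simp add: complex_norm_square del: of_real_power)
    also have "\<dots> = (\<Sum>j<d. \<Sum>k<2*d. u $ (k*d+j) * cnj (u $ (k*d+j)))"
      unfolding sum_mult_index[of _ "2*d" d] by (rule sum.swap)
    also have "\<dots> = (\<Sum>j<d. \<psi> $ j * cnj (\<psi> $ j))" by (intro sum.cong refl dens) auto
    also have "\<dots> = complex_of_real (\<Sum>j<d. (cmod (\<psi> $ j))\<^sup>2)"
      by (simp add: complex_norm_square del: of_real_power)
    also have "\<dots> = 1" using pure by (simp add: is_pure_state_def)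
    finally show ?thesis using of_real_eq_1_iff by blast
  qed
  have 1: "(\<Sum>i<M. (cmod (vkron u' u $ i))\<^sup>2) = 1"
  proof -
    have "(\<Sum>i<M. (cmod (vkron u' u $ i))\<^sup>2) = (\<Sum>a<?n. \<Sum>b<?n. (cmod (u $ a))\<^sup>2 * (cmod (u $ b))\<^sup>2)"
      unfolding M_def sum_mult_index[of _ ?n ?n]
      by (intro sum.cong refl) (simp add: idx norm_mult power_mult_distrib)
    also have "\<dots> = 1" by (simp add: sum_product[symmetric] nu)
    finally show ?thesis .
  qed
  have 2: "(\<Sum>i<M. vkron u' u $ i * cnj (vkron u' u $ swap_B d i)) = realness d \<psi>"
  proof -
    let ?r = "\<lambda>j j' k. u $ (k*d+j') * cnj (u $ (k*d+j))"
    have lt: "k*d+j < ?n" if "k < 2*d" "j < d" for k j using that by (rule pair_index_less)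
    have "(\<Sum>i<M. vkron u' u $ i * cnj (vkron u' u $ swap_B d i))
        = (\<Sum>k<2*d. \<Sum>j<d. \<Sum>k'<2*d. \<Sum>j'<d. ?r j j' k * ?r j j' k')"
      unfolding M_def sum_mult_index[of _ ?n ?n] sum_mult_index[of _ "2*d" d]
    proof (intro sum.cong refl)
      fix k j k' j' assume "k \<in> {..<2*d}" "j \<in> {..<d}" "k' \<in> {..<2*d}" "j' \<in> {..<d}"
      then have b: "k < 2*d" "j < d" "k' < 2*d" "j' < d" by auto
      show "vkron u' u $ ((k*d+j)*?n + (k'*d+j')) * cnj (vkron u' u $ swap_B d ((k*d+j)*?n + (k'*d+j')))
          = ?r j j' k * ?r j j' k'"
        unfolding swap_B_index[OF b] idx[OF lt[OF b(1,2)] lt[OF b(3,4)]] idx[OF lt[OF b(1,4)] lt[OF b(3,2)]]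
        by (simp add: mult_ac)
    qed
    \<comment> \<open>Moving the sums over \<open>k\<close> and \<open>k'\<close> inside lets them
      factor into two equal Gram sums, each evaluated by \<open>dens\<close>.\<close>
    also have "\<dots> = (\<Sum>j<d. \<Sum>k<2*d. \<Sum>j'<d. \<Sum>k'<2*d. ?r j j' k * ?r j j' k')"
      by (subst sum.swap, rule sum.cong[OF refl], rule sum.cong[OF refl], rule sum.swap)
    also have "\<dots> = (\<Sum>j<d. \<Sum>j'<d. \<Sum>k<2*d. \<Sum>k'<2*d. ?r j j' k * ?r j j' k')"
      by (rule sum.cong[OF refl], rule sum.swap)
    also have "\<dots> = (\<Sum>j<d. \<Sum>j'<d. (\<psi> $ j' * cnj (\<psi> $ j)) * (\<psi> $ j' * cnj (\<psi> $ j)))"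
      unfolding sum_product[symmetric] by (intro sum.cong refl) (simp add: dens)
    also have "\<dots> = (\<Sum>j<d. cnj ((\<psi> $ j)\<^sup>2)) * (\<Sum>j'<d. (\<psi> $ j')\<^sup>2)"
      unfolding sum_product by (intro sum.cong refl) (simp add: power2_eq_square mult_ac)
    also have "\<dots> = realness d \<psi>"
      by (simp add: realness_def complex_norm_square mult.commute del: of_real_power)
    finally show ?thesis .
  qed
  show ?thesis unfolding sym_mat_accept[OF p] 1 2 by simp
qed

section \<open>The algorithm with four queries\<close>

lemma accept_prob_vkron:
  assumes q: "q \<in> carrier_vec M"
  shows "accept_prob (M*M) {i. P (i div M) \<and> P (i mod M)} (vkron q q)
    = (\<Sum>i<M. if P i then (cmod (q $ i))\<^sup>2 else 0)\<^sup>2"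
proof -
  let ?A = "{i. P (i div M) \<and> P (i mod M)}"
  have "{i. i < M*M \<and> i \<in> ?A} = {..<M*M} \<inter> ?A" by auto
  then have "accept_prob (M*M) ?A (vkron q q)
      = (\<Sum>i<M*M. if i \<in> ?A then (cmod (vkron q q $ i))\<^sup>2 else 0)"
    unfolding accept_prob_def by (simp only: sum.inter_restrict[OF finite_lessThan])
  \<comment> \<open>The acceptance condition splits over the two halves of the index, so two
    independent runs accept with the product of their probabilities.\<close>
  also have "\<dots> = (\<Sum>a<M. \<Sum>b<M. (if P a then (cmod (q $ a))\<^sup>2 else 0) * (if P b then (cmod (q $ b))\<^sup>2 else 0))"
    unfolding sum_mult_index
    by (intro sum.cong refl) (auto simp: vkron_index[OF q q] norm_mult power_mult_distrib)
  also have "\<dots> = (\<Sum>i<M. if P i then (cmod (q $ i))\<^sup>2 else 0)\<^sup>2"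
    by (simp add: sum_product power2_eq_square)
  finally show ?thesis .
qed

lemma query_op_vkron:
  assumes "U \<in> carrier_mat n n" "x \<in> carrier_vec n" "r \<in> carrier_vec W"
  shows "query_op QU U W *\<^sub>v vkron x r = vkron (U *\<^sub>v x) r"
    and "query_op QUconj U W *\<^sub>v vkron x r = vkron (conj_mat U *\<^sub>v x) r"
proof -
  have c: "conj_mat U \<in> carrier_mat n n" using assms by (simp add: conj_mat_def)
  show "query_op QU U W *\<^sub>v vkron x r = vkron (U *\<^sub>v x) r"
    unfolding query_op_def query.case
    using kron_vkron[OF assms(1) one_carrier_mat assms(2,3)] one_mult_mat_vec[OF assms(3)] by simp
  show "query_op QUconj U W *\<^sub>v vkron x r = vkron (conj_mat U *\<^sub>v x) r"
    unfolding query_op_def query.case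
    using kron_vkron[OF c one_carrier_mat assms(2,3)] one_mult_mat_vec[OF assms(3)] by simp
qed

text \<open>Four registers of size \<open>n\<close>; a query touches only the first, and the cyclic
  shift \<open>R\<close> brings the next fresh one to the front. Alternating the query kinds leaves
  two copies of the conjugate state paired with the state.\<close>

lemma reality_conjugate_queries:
  assumes d: "d > 0"
  shows "\<exists>W V0 steps Acc. solves_reality d {QU, QUconj} W V0 steps Acc \<and>
           length (filter (\<lambda>s. fst s = QU) steps) = 2 \<and>
           length (filter (\<lambda>s. fst s = QUconj) steps) = 2 \<and>
           length steps = 4"
proof -
  define n where "n = 2*d*d"
  define W where "W = n*(n*n)"
  define M where "M = n*n"
  define R where "R = exchange_mat n W"
  define T where "T = sym_mat M (swap_B d)"
  define steps where "steps = [(QU, R), (QUconj, R), (QU, R), (QUconj, kron T T)]"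
  define Acc where "Acc = {i. i div M \<le> swap_B d (i div M) \<and> i mod M \<le> swap_B d (i mod M)}"
  have n: "n > 0" using d by (simp add: n_def)
  have N: "2*d*d*W = n*W" by (simp add: n_def)
  have NM: "n*W = M*M" by (simp add: W_def M_def)
  have T: "is_unitary M T"
    using involution.sym_mat_unitary[OF swap_B_involution[of d]] by (simp add: T_def M_def n_def)
  then have cT: "T \<in> carrier_mat M M" by (simp add: is_unitary_def)
  have R: "is_unitary (n*W) R" unfolding R_def by (rule exchange_mat_unitary)
  have alg: "is_alg d W (1\<^sub>m (n*W)) steps"
    unfolding is_alg_def N using n R kron_unitary[OF T T]
    by (auto simp: W_def one_unitary steps_def NM[unfolded W_def])
  have acc: "accept_prob (n*W) Acc (final_state d W (1\<^sub>m (n*W)) steps U) = ((1 + realness d \<psi>) / 2)\<^sup>2"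
    if pure: "is_pure_state d \<psi>" and prep: "state_prep d \<psi> U" for \<psi> U
  proof -
    define e where "e = (unit_vec n 0 :: complex vec)"
    define u where "u = U *\<^sub>v e"
    define u' where "u' = conj_mat U *\<^sub>v e"
    have U: "U \<in> carrier_mat n n" using prep by (simp add: state_prep_def is_unitary_def n_def)
    have e: "e \<in> carrier_vec n" by (simp add: e_def)
    have u: "u \<in> carrier_vec n" and u': "u' \<in> carrier_vec n"
      using U e by (auto simp: u_def u'_def conj_mat_def)
    have c3: "vkron x (vkron y z) \<in> carrier_vec W"
      if "x \<in> carrier_vec n" "y \<in> carrier_vec n" "z \<in> carrier_vec n" for x y z
      unfolding W_def by (intro vkron_carrier that)
    have step: "R *\<^sub>v vkron w (vkron x (vkron y z)) = vkron x (vkron y (vkron z w))"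
      if c: "w \<in> carrier_vec n" "x \<in> carrier_vec n" "y \<in> carrier_vec n" "z \<in> carrier_vec n" for w x y z
    proof -
      have "R *\<^sub>v vkron w (vkron x (vkron y z)) = vkron (vkron x (vkron y z)) w"
        unfolding R_def by (rule exchange_mat_vkron) (use c c3 in auto)
      also have "\<dots> = vkron x (vkron (vkron y z) w)"
        by (rule vkron_assoc[OF c(2) vkron_carrier[OF c(3,4)] c(1)])
      also have "\<dots> = vkron x (vkron y (vkron z w))" by (simp add: vkron_assoc[OF c(3,4,1)])
      finally show ?thesis .
    qed
    have QUs: "query_op QU U W *\<^sub>v vkron e (vkron x (vkron y z)) = vkron u (vkron x (vkron y z))"
      and QCs: "query_op QUconj U W *\<^sub>v vkron e (vkron x (vkron y z)) = vkron u' (vkron x (vkron y z))"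
      if "x \<in> carrier_vec n" "y \<in> carrier_vec n" "z \<in> carrier_vec n" for x y z
      using query_op_vkron[OF U e c3[OF that]] by (auto simp: u_def u'_def)
    have "1\<^sub>m (n*W) *\<^sub>v unit_vec (2*d*d*W) 0 = (unit_vec (n*W) 0 :: complex vec)"
      unfolding N by (rule one_mult_mat_vec) simp
    also have "\<dots> = vkron e (vkron e (vkron e e))"
      using n by (simp add: e_def vkron_unit W_def)
    finally have init: "1\<^sub>m (n*W) *\<^sub>v unit_vec (2*d*d*W) 0 = vkron e (vkron e (vkron e e))" .
    \<comment> \<open>No shift follows the last query, so the order of the registers is
      \<open>u'\<close>, \<open>u\<close>, \<open>u'\<close>, \<open>u\<close>, and each half is one
      input of the swap test.\<close>
    have "final_state d W (1\<^sub>m (n*W)) steps U = kron T T *\<^sub>v vkron u' (vkron u (vkron u' u))"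
      unfolding final_state_def init steps_def using e u u' by (simp add: QUs QCs step)
    also have "vkron u' (vkron u (vkron u' u)) = vkron (vkron u' u) (vkron u' u)"
      by (rule vkron_assoc[symmetric, OF u' u vkron_carrier[OF u' u]])
    also have "kron T T *\<^sub>v \<dots> = vkron (T *\<^sub>v vkron u' u) (T *\<^sub>v vkron u' u)"
      using vkron_carrier[OF u' u] by (intro kron_vkron[OF cT cT]) (auto simp: M_def)
    finally have fin: "final_state d W (1\<^sub>m (n*W)) steps U = vkron (T *\<^sub>v vkron u' u) (T *\<^sub>v vkron u' u)" .
    have q: "T *\<^sub>v vkron u' u \<in> carrier_vec M"
      using cT vkron_carrier[OF u' u] by (intro mult_mat_vec_carrier) (auto simp: M_def)
    have "accept_prob (n*W) Acc (final_state d W (1\<^sub>m (n*W)) steps U)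
        = (\<Sum>i<M. if i \<le> swap_B d i then (cmod ((T *\<^sub>v vkron u' u) $ i))\<^sup>2 else 0)\<^sup>2"
      unfolding fin unfolding NM Acc_def by (rule accept_prob_vkron[OF q, of "\<lambda>i. i \<le> swap_B d i"])
    also have "(\<Sum>i<M. if i \<le> swap_B d i then (cmod ((T *\<^sub>v vkron u' u) $ i))\<^sup>2 else 0) = (1 + realness d \<psi>) / 2"
      unfolding T_def M_def u_def u'_def e_def n_def by (rule swap_test_accept[OF prep pure])
    finally show ?thesis .
  qed
  have "solves_reality d {QU, QUconj} W (1\<^sub>m (n*W)) steps Acc"
    unfolding solves_reality_def N
  proof (intro conjI allI impI)
    show "is_alg d W (1\<^sub>m (n*W)) steps" by (rule alg)
    show "fst ` set steps \<subseteq> {QU, QUconj}" by (auto simp: steps_def)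
    fix \<psi> U assume pp: "is_pure_state d \<psi> \<and> state_prep d \<psi> U"
    note a = acc[OF conjunct1[OF pp] conjunct2[OF pp]]
    show "2/3 \<le> accept_prob (n*W) Acc (final_state d W (1\<^sub>m (n*W)) steps U)" if "realness d \<psi> = 1"
      unfolding a using that by simp
    show "accept_prob (n*W) Acc (final_state d W (1\<^sub>m (n*W)) steps U) \<le> 1/3" if "realness d \<psi> < 1/10"
    proof -
      \<comment> \<open>Realness below 1/10 makes a single test accept with probability below 0.55,
        which is not enough; squared, the bound is 0.3025, below 1/3. Realness 1 is accepted with
        certainty.\<close>
      have "((1 + realness d \<psi>) / 2)\<^sup>2 \<le> (0.55)\<^sup>2"
        using that by (intro power_mono) (auto simp: realness_def)
      then show ?thesis unfolding a by (simp add: power2_eq_square)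
    qed
  qed
  moreover have "length (filter (\<lambda>s. fst s = QU) steps) = 2"
    "length (filter (\<lambda>s. fst s = QUconj) steps) = 2" "length steps = 4"
    by (auto simp: steps_def)
  ultimately show ?thesis by blast
qed

theorem theorem1p3:
  shows "(\<exists>c>0. \<forall>d::nat. d > 1000 \<longrightarrow>
            (\<forall>W V0 steps Acc. solves_reality d {QU, QUdag} W V0 steps Acc \<longrightarrow>
               real (length steps) \<ge> c * real d powr (1/4)))
       \<and> (\<forall>d::nat. d > 1000 \<longrightarrow>
            (\<exists>W V0 steps Acc. solves_reality d {QU, QUconj} W V0 steps Acc \<and>
               length (filter (\<lambda>s. fst s = QU) steps) = 2 \<and>
               length (filter (\<lambda>s. fst s = QUconj) steps) = 2 \<and>
               length steps = 4))"
proof (rule conjI)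
  show "\<exists>c>0. \<forall>d::nat. d > 1000 \<longrightarrow>
            (\<forall>W V0 steps Acc. solves_reality d {QU, QUdag} W V0 steps Acc \<longrightarrow>
               real (length steps) \<ge> c * real d powr (1/4))"
    using reality_query_lower_bound by (intro exI[of _ "1/12"]) auto
qed (use reality_conjugate_queries in auto)

end
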